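(* Let $R$ be an aperiodic vertically unbounded two-step rule, let $x\in(0,\infty)$ and take $y>\tau(x)$. Then the vertical drift $\delta_{\mathbf y}(x,y)$ is positive. For each step direction $\theta$, the dominant singularity of the half-plane generating function $H_\theta(t;x,y)$ (as a function of $t$) is a simple pole at $t=\rho(x,y)$. Near $t=\rho(x,y)$, $$H_\theta(t;x,y)\underset{t\to\rho(x,y)}{\sim}c^+(x,y)\,\frac{1}{1-t/\rho(x,y)},$$ where $$c^+(x,y)=\frac{C_\theta(\rho(x,y);x,y)-D_\theta(\rho(x,y);x,y)\,H^*(\rho(x,y);x,0)}{\rho(x,y)\,B_\theta^{(1,0,0)}(\rho(x,y);x,y)}.$$ Thus $$\Theta_m^+(x,y)\sim c^+(x,y)\,\mu(x,y)^m\qquad\text{as }m\to\infty,$$ where $\mu(x,y)=1/\rho(x,y)$.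
   Context: Steps on $\mathbb Z^2$: east $(1,0)$, north $(0,1)$, west $(-1,0)$, south $(0,-1)$, abbreviated $e,n,w,s$. A two-step rule is a map $R:\{e,n,w,s\}^2\to\{0,1\}$; $R(i,j)=1$ means a step of type $i$ may be immediately followed by one of type $j$. Its transfer matrix is $T=(R(i,j))_{i,j}$. The rule is aperiodic if there is $k\ge1$ with $(T^k)_{ij}>0$ for all $i,j$. A rule is north-bound if there is always a north step between each pair of south steps, south-bound if there is always a south step between each pair of north steps, and vertically unbounded if it is neither. A walk obeying $R$ is a nonempty finite sequence of steps, starting at the origin, with arbitrary first step and with $R(i,j)=1$ for each consecutive pair $(i,j)$. The generating function of a class of walks is $\sum t^m x^a y^b$ over walks in the class, where $m$ is the length and $(a,b)$ the endpoint. $B_\theta$: full-plane walks obeying $R$ whose first step $j$ satisfies $R(\theta,j)=1$, containing exactly one $\theta$ step, which is their last step. $C_\theta$ (resp. $D_\theta$): full-plane walks obeying $R$ which do not (resp. do) start with a south step and contain exactly one $\theta$ step, which is their last step. $B_\theta,C_\theta,D_\theta$ are rational functions; a superscript $(i,j,k)$ denotes the partial derivative taken $i$ times in $t$, $j$ in $x$, $k$ in $y$. $H_\theta(t;x,y)=\sum_m\Theta^+_m(x,y)t^m$: walks obeying $R$, starting at the origin, staying in $\{(a,b):b\ge0\}$, with last step $\theta$. $H^*(t;x,y)=\sum_{\phi:\,R(\phi,s)=1}H_\phi(t;x,y)$, and $H^*(t;x,0)$ is its value at $y=0$. For $x,y\in(0,\infty)$, $\rho(x,y)$ is the smallest positive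 $t$ with $B_\theta(t;x,y)=1$ (it exists and is independent of $\theta$), and $\mu(x,y)=1/\rho(x,y)$. The vertical drift is $\delta_{\mathbf y}(x,y)=\frac{B_\theta^{(0,0,1)}(\rho;x,y)}{\rho B_\theta^{(1,0,0)}(\rho;x,y)}=\frac{\partial}{\partial y}\log\mu(x,y)$, with $\rho=\rho(x,y)$. For fixed $x$, $\rho(x,\cdot)$ is increasing and then decreasing on $(0,\infty)$; $\tau(x)$ is the unique point where $\partial\rho/\partial y=0$. A dominant singularity is a singularity closest to $t=0$. *)

theory Defs
  imports "HOL-Complex_Analysis.Complex_Analysis" "HOL-Library.Landau_Symbols"
begin

datatype step = East | North | West | South

instance step :: finite
proof
  have "(UNIV :: step set) = {East, North, West, South}"
    using step.exhaust by auto
  then show "finite (UNIV :: step set)"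
    by (metis finite.emptyI finite.insertI)
qed

fun step_vec :: "step \<Rightarrow> int \<times> int" where
  "step_vec East = (1, 0)"
| "step_vec North = (0, 1)"
| "step_vec West = (-1, 0)"
| "step_vec South = (0, -1)"

type_synonym rule = "step \<Rightarrow> step \<Rightarrow> bool"

definition transfer_matrix :: "rule \<Rightarrow> real^step^step" where
  "transfer_matrix R = (\<chi> i j. of_bool (R i j))"

text \<open>The matrix power is spelled out as an iterated product, because \<open>^\<close> on type
  \<open>real^step^step\<close> is the entrywise power.\<close>

definition aperiodic :: "rule \<Rightarrow> bool" where
  "aperiodic R \<longleftrightarrow>
     (\<exists>k\<ge>1. \<forall>i j. (((**) (transfer_matrix R) ^^ k) (mat 1)) $ i $ j > 0)"

definition walk :: "rule \<Rightarrow> step list \<Rightarrow> bool" where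
  "walk R w \<longleftrightarrow> w \<noteq> [] \<and> (\<forall>i. Suc i < length w \<longrightarrow> R (w ! i) (w ! Suc i))"

definition endpoint :: "step list \<Rightarrow> int \<times> int" where
  "endpoint w = sum_list (map step_vec w)"

definition north_bound :: "rule \<Rightarrow> bool" where
  "north_bound R \<longleftrightarrow>
     (\<forall>w i j. walk R w \<and> i < j \<and> j < length w \<and> w ! i = South \<and> w ! j = South
        \<longrightarrow> (\<exists>k. i < k \<and> k < j \<and> w ! k = North))"

definition south_bound :: "rule \<Rightarrow> bool" where
  "south_bound R \<longleftrightarrow>
     (\<forall>w i j. walk R w \<and> i < j \<and> j < length w \<and> w ! i = North \<and> w ! j = North
        \<longrightarrow> (\<exists>k. i < k \<and> k < j \<and> w ! k = South))"

definition vertically_unbounded :: "rule \<Rightarrow> bool" where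
  "vertically_unbounded R \<longleftrightarrow> \<not> north_bound R \<and> \<not> south_bound R"

definition gf_coeff :: "step list set \<Rightarrow> nat \<Rightarrow> real \<Rightarrow> real \<Rightarrow> real" where
  "gf_coeff W m x y =
     (\<Sum>w | w \<in> W \<and> length w = m. x powi fst (endpoint w) * y powi snd (endpoint w))"

text \<open>Generating functions are evaluated as sums of their power series in \<open>t\<close>, hence are
  meaningful only inside the disc of convergence. For the rational functions \<open>B\<close>, \<open>C\<close> and \<open>D\<close>
  below, the point \<open>t = rho R x y\<close> at which they are used lies inside that disc.\<close>

definition gf :: "step list set \<Rightarrow> real \<Rightarrow> real \<Rightarrow> real \<Rightarrow> real" where
  "gf W t x y = (\<Sum>m. gf_coeff W m x y * t ^ m)"

definition B_walks :: "rule \<Rightarrow> step \<Rightarrow> step list set" where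
  "B_walks R \<theta> = {w. walk R w \<and> R \<theta> (hd w) \<and> count_list w \<theta> = 1 \<and> last w = \<theta>}"

definition C_walks :: "rule \<Rightarrow> step \<Rightarrow> step list set" where
  "C_walks R \<theta> = {w. walk R w \<and> hd w \<noteq> South \<and> count_list w \<theta> = 1 \<and> last w = \<theta>}"

definition D_walks :: "rule \<Rightarrow> step \<Rightarrow> step list set" where
  "D_walks R \<theta> = {w. walk R w \<and> hd w = South \<and> count_list w \<theta> = 1 \<and> last w = \<theta>}"

definition H_walks :: "rule \<Rightarrow> step \<Rightarrow> step list set" where
  "H_walks R \<theta> =
     {w. walk R w \<and> (\<forall>k\<le>length w. snd (endpoint (take k w)) \<ge> 0) \<and> last w = \<theta>}"

definition H_star :: "rule \<Rightarrow> real \<Rightarrow> real \<Rightarrow> real \<Rightarrow> real" where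
  "H_star R t x y = (\<Sum>\<phi> | R \<phi> South. gf (H_walks R \<phi>) t x y)"

definition B_t :: "rule \<Rightarrow> step \<Rightarrow> real \<Rightarrow> real \<Rightarrow> real \<Rightarrow> real" where
  "B_t R \<theta> t x y = deriv (\<lambda>u. gf (B_walks R \<theta>) u x y) t"

definition B_y :: "rule \<Rightarrow> step \<Rightarrow> real \<Rightarrow> real \<Rightarrow> real \<Rightarrow> real" where
  "B_y R \<theta> t x y = deriv (\<lambda>u. gf (B_walks R \<theta>) t x u) y"

text \<open>\<open>sums 1\<close> instead of \<open>gf (B_walks R \<theta>) t x y = 1\<close> excludes points \<open>t\<close> at which the
  series diverges and \<open>suminf\<close> has an unspecified value.\<close>

definition is_smallest_root :: "rule \<Rightarrow> step \<Rightarrow> real \<Rightarrow> real \<Rightarrow> real \<Rightarrow> bool" where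
  "is_smallest_root R \<theta> x y t \<longleftrightarrow>
     0 < t \<and> (\<lambda>m. gf_coeff (B_walks R \<theta>) m x y * t ^ m) sums 1 \<and>
     (\<forall>u. 0 < u \<and> (\<lambda>m. gf_coeff (B_walks R \<theta>) m x y * u ^ m) sums 1 \<longrightarrow> t \<le> u)"

text \<open>The smallest root does not depend on \<open>\<theta>\<close> when \<open>R\<close> is aperiodic.\<close>

definition rho :: "rule \<Rightarrow> real \<Rightarrow> real \<Rightarrow> real" where
  "rho R x y = (THE t. \<forall>\<theta>. is_smallest_root R \<theta> x y t)"

definition mu :: "rule \<Rightarrow> real \<Rightarrow> real \<Rightarrow> real" where
  "mu R x y = 1 / rho R x y"

text \<open>This is the \<open>y\<close>-derivative of \<open>ln (mu R x y)\<close>, by implicit differentiation of the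
  equation defining \<open>rho\<close>; its value does not depend on \<open>\<theta>\<close>.\<close>

definition vertical_drift :: "rule \<Rightarrow> step \<Rightarrow> real \<Rightarrow> real \<Rightarrow> real" where
  "vertical_drift R \<theta> x y =
     B_y R \<theta> (rho R x y) x y / (rho R x y * B_t R \<theta> (rho R x y) x y)"

definition tau :: "rule \<Rightarrow> real \<Rightarrow> real" where
  "tau R x = (THE y. 0 < y \<and> (rho R x has_real_derivative 0) (at y))"

definition c_plus :: "rule \<Rightarrow> step \<Rightarrow> real \<Rightarrow> real \<Rightarrow> real" where
  "c_plus R \<theta> x y =
     (let r = rho R x y in
        (gf (C_walks R \<theta>) r x y - gf (D_walks R \<theta>) r x y * H_star R r x 0)
          / (r * B_t R \<theta> r x y))"

text \<open>The power series with coefficients \<open>a\<close> converges to \<open>h\<close> on the open disc of radius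
  \<open>norm p\<close>, and \<open>h\<close> continues it analytically to a larger disc except for a simple pole at
  \<open>p\<close>. So \<open>p\<close> is the only singularity of least modulus.\<close>

definition dominant_simple_pole ::
    "(nat \<Rightarrow> complex) \<Rightarrow> complex \<Rightarrow> (complex \<Rightarrow> complex) \<Rightarrow> bool" where
  "dominant_simple_pole a p h \<longleftrightarrow>
     (\<forall>t\<in>ball 0 (norm p). (\<lambda>m. a m * t ^ m) sums h t) \<and>
     (\<exists>r>norm p. h holomorphic_on (ball 0 r - {p})) \<and>
     is_pole h p \<and> zorder h p = -1"

end

theory Submission
  imports Defs
begin

text \<open>
  Fix \<open>x\<close>. A positive Perron vector of the weighted transfer matrix at \<open>y\<close>, with eigenvalue \<open>\<mu>\<close>, turns
  walks obeying the rule into paths of an irreducible Markov chain on the four steps. Recurrence of this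
  finite chain says that the return series \<open>B\<close> takes the value 1 at \<open>1 / \<mu>\<close>, for every step \<open>\<theta>\<close> at once,
  so \<open>rho R x y = 1 / \<mu>\<close>; since the probability of avoiding \<open>\<theta>\<close> decays geometrically, \<open>B\<close>, \<open>C\<close> and \<open>D\<close>
  converge in a disc larger than \<open>\<bar>t\<bar> \<le> 1 / \<mu>\<close>. By aperiodicity \<open>1 / \<mu>\<close> is the only solution of \<open>B = 1\<close>
  in the closed disc, and it is simple (\<open>perron.B_sums_1\<close>, \<open>perron.B_decay\<close>, \<open>perron.B_unique_root\<close>).

  Removing the last step of a half-plane walk gives a linear system for the \<open>H \<phi>\<close>. Pairing it with the
  first-passage series to \<open>\<theta>\<close>, which solve the transposed system, eliminates all unknowns but \<open>H \<theta>\<close> and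
  the walks ending on the ground: \<open>H \<theta> * (1 - B) = C - D * Hstar\<close>, where \<open>Hstar\<close> is taken at height zero
  (\<open>kernel_equation\<close>).

  In the variables \<open>ln t\<close> and \<open>ln y\<close> the series \<open>B\<close> is a sum of exponentials of linear functions, hence
  convex, and the curve \<open>B = 1\<close> is the graph of the concave function \<open>ln (rho R x y)\<close> of \<open>ln y\<close>. Loops
  of negative and of positive height force \<open>rho R x\<close> to tend to 0 at both ends, so it has exactly one
  critical point \<open>tau R x\<close>, its strict maximum; beyond it \<open>rho R x\<close> lies below \<open>rho R x (tau R x)\<close> and the
  derivative of its logarithm, which is minus the drift, is negative (\<open>perron.rho_supporting_line\<close>,
  \<open>perron.rho_derivative\<close>, \<open>above_tau\<close>).

  A half-plane walk ending on the ground has the same weight for every \<open>y\<close>. Comparing with \<open>tau R x\<close>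
  shows that \<open>Hstar\<close> has radius of convergence at least \<open>rho R x (tau R x)\<close>, which exceeds \<open>rho R x y\<close>. The
  kernel equation therefore continues \<open>H \<theta>\<close> to a larger disc with at most a simple pole at \<open>rho R x y\<close>,
  and the coefficients times \<open>rho R x y ^ m\<close> converge to \<open>c_plus\<close> (\<open>renewal_factorization\<close>,
  \<open>coefficient_limit\<close>).

  The pole is genuine because \<open>c_plus\<close> is positive. The Perron vector at \<open>tau R x\<close> provides a
  supermartingale that decays exponentially with the height, so a walk started high enough rarely comes
  down, and a loop with a north step and no south step lifts a walk to any height at positive cost
  (\<open>doomed_walks_le\<close>, \<open>H_lower\<close>).
\<close>

section \<open>Weights of walks\<close>

definition step_weight :: "real \<Rightarrow> real \<Rightarrow> step \<Rightarrow> real" where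
  "step_weight x y s = x powi fst (step_vec s) * y powi snd (step_vec s)"

definition walk_weight :: "real \<Rightarrow> real \<Rightarrow> step list \<Rightarrow> real" where
  "walk_weight x y w = x powi fst (endpoint w) * y powi snd (endpoint w)"

lemma endpoint_simps [simp]:
  "endpoint [] = (0, 0)" "endpoint (s # w) = step_vec s + endpoint w"
  "endpoint (u @ w) = endpoint u + endpoint w"
  by (auto simp: endpoint_def zero_prod_def)

lemma walk_weight_Cons:
  assumes "x \<noteq> 0" "y \<noteq> 0"
  shows "walk_weight x y (s # w) = step_weight x y s * walk_weight x y w"
  using assms by (simp add: walk_weight_def step_weight_def power_int_add)

lemma walk_weight_snoc:
  assumes "x \<noteq> 0" "y \<noteq> 0"
  shows "walk_weight x y (w @ [s]) = step_weight x y s * walk_weight x y w"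
  using assms by (simp add: walk_weight_def step_weight_def power_int_add endpoint_def)

lemma walk_weight_Nil [simp]: "walk_weight x y [] = 1"
  by (simp add: walk_weight_def)

lemma step_weight_pos: "0 < x \<Longrightarrow> 0 < y \<Longrightarrow> 0 < step_weight x y s"
  by (simp add: step_weight_def)

lemma walk_weight_pos: "0 < x \<Longrightarrow> 0 < y \<Longrightarrow> 0 < walk_weight x y w"
  by (simp add: walk_weight_def)

lemma walk_iff_successively: "walk R w \<longleftrightarrow> w \<noteq> [] \<and> successively R w"
  by (auto simp: walk_def successively_conv_nth)

lemma walk_simps [simp]:
  "\<not> walk R []" "walk R (s # w) \<longleftrightarrow> w = [] \<or> (R s (hd w) \<and> walk R w)"
  by (auto simp: walk_iff_successively successively_Cons)

lemma walk_snoc: "walk R (w @ [s]) \<longleftrightarrow> w = [] \<or> (R (last w) s \<and> walk R w)"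
  by (auto simp: walk_iff_successively successively_append_iff)

lemma finite_walks_of_length [simp]: "finite {w :: step list. w \<in> W \<and> length w = n}"
  by (rule finite_subset[OF _ finite_lists_length_eq[of "UNIV :: step set" n]]) auto

lemma gf_coeff_eq: "gf_coeff W n x y = (\<Sum>w | w \<in> W \<and> length w = n. walk_weight x y w)"
  by (simp add: gf_coeff_def walk_weight_def)

lemma gf_coeff_nonneg: "0 < x \<Longrightarrow> 0 \<le> y \<Longrightarrow> 0 \<le> gf_coeff W n x y"
  by (auto simp: gf_coeff_def intro!: sum_nonneg)

lemma gf_coeff_mono:
  "V \<subseteq> W \<Longrightarrow> 0 < x \<Longrightarrow> 0 \<le> y \<Longrightarrow> gf_coeff V n x y \<le> gf_coeff W n x y"
  unfolding gf_coeff_def by (rule sum_mono2) auto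

lemma gf_coeff_empty [simp]: "gf_coeff {} n x y = 0"
  by (simp add: gf_coeff_def)

lemma gf_coeff_single: "gf_coeff {w} n x y = (if length w = n then walk_weight x y w else 0)"
proof -
  have "{v. v \<in> {w} \<and> length v = n} = (if length w = n then {w} else {})" by auto
  then show ?thesis by (simp add: gf_coeff_eq)
qed

lemma gf_coeff_Un_disjoint:
  "V \<inter> W = {} \<Longrightarrow> gf_coeff (V \<union> W) n x y = gf_coeff V n x y + gf_coeff W n x y"
  unfolding gf_coeff_def by (subst sum.union_disjoint[symmetric]) (auto intro!: sum.cong)

lemma gf_coeff_insert:
  "w \<notin> W \<Longrightarrow> gf_coeff (insert w W) n x y =
    (if length w = n then walk_weight x y w else 0) + gf_coeff W n x y"
  using gf_coeff_Un_disjoint[of "{w}" W n x y] by (simp add: gf_coeff_single)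

lemma gf_coeff_UN_disjoint:
  assumes "finite I" and "\<And>i j. i \<in> I \<Longrightarrow> j \<in> I \<Longrightarrow> i \<noteq> j \<Longrightarrow> W i \<inter> W j = {}"
  shows "gf_coeff (\<Union>i\<in>I. W i) n x y = (\<Sum>i\<in>I. gf_coeff (W i) n x y)"
proof -
  have "{w. w \<in> (\<Union>i\<in>I. W i) \<and> length w = n} = (\<Union>i\<in>I. {w. w \<in> W i \<and> length w = n})"
    by auto
  then show ?thesis
    unfolding gf_coeff_def using assms by (subst sum.UNION_disjoint[symmetric]) auto
qed

text \<open>
  Adding a step at either end of every walk shifts the generating function by one power of \<open>t\<close> and
  multiplies it by the weight of the step. All recursions below come from this.
\<close>

lemma gf_coeff_image:
  assumes "inj f" and "\<And>w. length (f w) = Suc (length w)"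
    and "\<And>w. walk_weight x y (f w) = c * walk_weight x y w"
  shows "gf_coeff (f ` W) (Suc n) x y = c * gf_coeff W n x y"
proof -
  have "{w. w \<in> f ` W \<and> length w = Suc n} = f ` {w. w \<in> W \<and> length w = n}"
    using assms(2) by auto
  moreover have "inj_on f A" for A
    using assms(1) by (rule inj_on_subset) simp
  ultimately show ?thesis
    by (simp add: gf_coeff_eq sum.reindex assms(3) sum_distrib_left)
qed

lemma gf_coeff_Cons:
  assumes "x \<noteq> 0" "y \<noteq> 0"
  shows "gf_coeff ((#) s ` W) (Suc n) x y = step_weight x y s * gf_coeff W n x y"
  by (rule gf_coeff_image) (auto simp: walk_weight_Cons[OF assms])

lemma gf_coeff_snoc:
  assumes "x \<noteq> 0" "y \<noteq> 0"
  shows "gf_coeff ((\<lambda>w. w @ [s]) ` W) (Suc n) x y = step_weight x y s * gf_coeff W n x y"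
  by (rule gf_coeff_image) (auto simp: walk_weight_snoc[OF assms] inj_on_def)

lemma gf_coeff_zero: "\<not> [] \<in> W \<Longrightarrow> gf_coeff W 0 x y = 0"
proof -
  assume "\<not> [] \<in> W"
  then have *: "{w. w \<in> W \<and> length w = 0} = {}" by auto
  show ?thesis unfolding gf_coeff_def * by simp
qed

section \<open>First passages\<close>

definition passage_walks :: "rule \<Rightarrow> step \<Rightarrow> step \<Rightarrow> step list set" where
  "passage_walks R \<theta> s = {w. walk R w \<and> hd w = s \<and> count_list w \<theta> = 1 \<and> last w = \<theta>}"

lemma passage_walks_disjoint: "s \<noteq> s' \<Longrightarrow> passage_walks R \<theta> s \<inter> passage_walks R \<theta> s' = {}"
  by (auto simp: passage_walks_def)

lemma B_walks_eq: "B_walks R \<theta> = (\<Union>s\<in>{s. R \<theta> s}. passage_walks R \<theta> s)"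
  by (auto simp: B_walks_def passage_walks_def)

lemma C_walks_eq: "C_walks R \<theta> = (\<Union>s\<in>UNIV - {South}. passage_walks R \<theta> s)"
  by (auto simp: C_walks_def passage_walks_def)

lemma D_walks_eq: "D_walks R \<theta> = passage_walks R \<theta> South"
  by (auto simp: D_walks_def passage_walks_def)

lemma passage_walks_target: "passage_walks R \<theta> \<theta> = {[\<theta>]}"
proof -
  have "w = [\<theta>]" if "w \<in> passage_walks R \<theta> \<theta>" for w
  proof (cases w)
    case (Cons s u)
    then have "s = \<theta>" "count_list u \<theta> = 0" "last w = \<theta>"
      using that by (auto simp: passage_walks_def)
    then show ?thesis
      using Cons by (cases "u = []") (auto simp: count_list_0_iff)
  qed (use that in \<open>simp add: passage_walks_def\<close>)
  then show ?thesis by (auto simp: passage_walks_def)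
qed

lemma passage_walks_step:
  assumes "s \<noteq> \<theta>"
  shows "passage_walks R \<theta> s = (#) s ` (\<Union>l\<in>{l. R s l}. passage_walks R \<theta> l)"
proof (intro equalityI subsetI)
  fix w assume w: "w \<in> passage_walks R \<theta> s"
  then obtain u where "w = s # u" by (cases w) (auto simp: passage_walks_def)
  then show "w \<in> (#) s ` (\<Union>l\<in>{l. R s l}. passage_walks R \<theta> l)"
    using w assms by (auto simp: passage_walks_def split: if_splits)
next
  fix w assume "w \<in> (#) s ` (\<Union>l\<in>{l. R s l}. passage_walks R \<theta> l)"
  then show "w \<in> passage_walks R \<theta> s"
    using assms by (auto simp: passage_walks_def)
qed

lemma passage_coeff_0 [simp]: "gf_coeff (passage_walks R \<theta> s) 0 x y = 0"
  by (rule gf_coeff_zero) (simp add: passage_walks_def)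

lemma passage_coeff_Suc:
  assumes "x \<noteq> 0" "y \<noteq> 0"
  shows "gf_coeff (passage_walks R \<theta> s) (Suc n) x y =
    step_weight x y s *
      (if s = \<theta> then of_bool (n = 0) else \<Sum>l | R s l. gf_coeff (passage_walks R \<theta> l) n x y)"
proof (cases "s = \<theta>")
  case True
  then show ?thesis
    using assms by (simp add: passage_walks_target gf_coeff_single walk_weight_Cons)
next
  case False
  show ?thesis
    using False assms
    by (subst passage_walks_step)
       (auto simp: gf_coeff_Cons gf_coeff_UN_disjoint passage_walks_disjoint)
qed

lemma B_coeff:
  "gf_coeff (B_walks R \<theta>) n x y = (\<Sum>s | R \<theta> s. gf_coeff (passage_walks R \<theta> s) n x y)"
  unfolding B_walks_eq by (rule gf_coeff_UN_disjoint) (auto simp: passage_walks_disjoint)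

lemma C_coeff:
  "gf_coeff (C_walks R \<theta>) n x y = (\<Sum>s\<in>UNIV - {South}. gf_coeff (passage_walks R \<theta> s) n x y)"
  unfolding C_walks_eq by (rule gf_coeff_UN_disjoint) (auto simp: passage_walks_disjoint)

section \<open>Walks above a floor\<close>

definition height :: "step list \<Rightarrow> int" where
  "height w = snd (endpoint w)"

definition rise :: "step \<Rightarrow> int" where
  "rise s = snd (step_vec s)"

lemma height_simps [simp]:
  "height [] = 0" "height (s # w) = rise s + height w" "height (u @ w) = height u + height w"
  by (auto simp: height_def rise_def)

text \<open>
  The floor is \<open>b\<close> below the start. The heights are constrained only after the first step, which makes
  the family closed under removing that step.
\<close>

definition floored_walks :: "rule \<Rightarrow> step \<Rightarrow> int \<Rightarrow> step \<Rightarrow> step list set" where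
  "floored_walks R \<theta> b s =
     {w. walk R w \<and> hd w = s \<and> last w = \<theta> \<and> (\<forall>k\<in>{1..length w}. 0 \<le> b + height (take k w))}"

lemma floored_walks_disjoint: "s \<noteq> s' \<Longrightarrow> floored_walks R \<theta> b s \<inter> floored_walks R \<theta> b s' = {}"
  by (auto simp: floored_walks_def)

lemma H_walks_eq: "H_walks R \<theta> = (\<Union>s. floored_walks R \<theta> 0 s)"
proof -
  have "(\<forall>k\<le>length w. 0 \<le> height (take k w)) \<longleftrightarrow> (\<forall>k\<in>{1..length w}. 0 \<le> height (take k w))"
    for w
    by (metis One_nat_def Suc_leI atLeastAtMost_iff height_simps(1) linorder_le_less_linear order_le_less
        take0 verit_comp_simplify1(3) zero_less_iff_neq_zero)
  then show ?thesis
    by (auto simp: H_walks_def floored_walks_def height_def)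
qed

lemma ball_atLeastAtMost_Suc:
  "(\<forall>k\<in>{Suc 0..Suc n}. P k) \<longleftrightarrow> P (Suc 0) \<and> (\<forall>k\<in>{Suc 0..n}. P (Suc k))"
proof (intro iffI ballI)
  fix k assume P: "P (Suc 0) \<and> (\<forall>k\<in>{Suc 0..n}. P (Suc k))" and k: "k \<in> {Suc 0..Suc n}"
  show "P k"
  proof (cases k)
    case (Suc m)
    then show ?thesis using P k by (cases "m = 0") auto
  qed (use k in simp)
qed auto

lemma floored_walks_step:
  "floored_walks R \<theta> b s =
     (if 0 \<le> b + rise s
      then (if s = \<theta> then {[\<theta>]} else {}) \<union> (#) s ` (\<Union>l\<in>{l. R s l}. floored_walks R \<theta> (b + rise s) l)
      else {})"
proof (intro set_eqI)
  fix w
  show "w \<in> floored_walks R \<theta> b s \<longleftrightarrow> w \<in> (if 0 \<le> b + rise s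
      then (if s = \<theta> then {[\<theta>]} else {}) \<union> (#) s ` (\<Union>l\<in>{l. R s l}. floored_walks R \<theta> (b + rise s) l)
      else {})"
  proof (cases w)
    case Nil
    then show ?thesis by (auto simp: floored_walks_def)
  next
    case (Cons i u)
    show ?thesis
      unfolding Cons floored_walks_def
      by (cases "u = []") (auto simp: ball_atLeastAtMost_Suc add.assoc)
  qed
qed

lemma floored_coeff_0 [simp]: "gf_coeff (floored_walks R \<theta> b s) 0 x y = 0"
  by (rule gf_coeff_zero) (simp add: floored_walks_def)

lemma floored_coeff_Suc:
  assumes "x \<noteq> 0" "y \<noteq> 0"
  shows "gf_coeff (floored_walks R \<theta> b s) (Suc n) x y =
    (if 0 \<le> b + rise s
     then step_weight x y s *
       (of_bool (n = 0 \<and> s = \<theta>) + (\<Sum>l | R s l. gf_coeff (floored_walks R \<theta> (b + rise s) l) n x y))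
     else 0)"
proof -
  define U where "U = (\<Union>l\<in>{l. R s l}. floored_walks R \<theta> (b + rise s) l)"
  have U: "gf_coeff U n x y = (\<Sum>l | R s l. gf_coeff (floored_walks R \<theta> (b + rise s) l) n x y)"
    unfolding U_def by (rule gf_coeff_UN_disjoint) (auto simp: floored_walks_disjoint)
  have U0: "gf_coeff U 0 x y = 0"
    by (rule gf_coeff_zero) (auto simp: U_def floored_walks_def)
  have "[\<theta>] \<notin> (#) s ` U"
    by (auto simp: U_def floored_walks_def)
  then show ?thesis
    using assms unfolding floored_walks_step[of R \<theta> b s] U_def[symmetric]
    by
       (auto simp: gf_coeff_insert gf_coeff_Cons walk_weight_Cons U U0 distrib_left)
qed

lemma H_coeff_floored:
  "gf_coeff (H_walks R \<theta>) n x y = (\<Sum>s\<in>UNIV. gf_coeff (floored_walks R \<theta> 0 s) n x y)"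
  unfolding H_walks_eq by (rule gf_coeff_UN_disjoint) (auto simp: floored_walks_disjoint)

definition walks_from_to :: "rule \<Rightarrow> step \<Rightarrow> step \<Rightarrow> step list set" where
  "walks_from_to R \<theta> s = {w. walk R w \<and> hd w = s \<and> last w = \<theta>}"

lemma walks_from_to_step:
  "walks_from_to R \<theta> s =
     (if s = \<theta> then {[\<theta>]} else {}) \<union> (#) s ` (\<Union>l\<in>{l. R s l}. walks_from_to R \<theta> l)"
proof (intro set_eqI)
  fix w
  show "w \<in> walks_from_to R \<theta> s \<longleftrightarrow>
    w \<in> (if s = \<theta> then {[\<theta>]} else {}) \<union> (#) s ` (\<Union>l\<in>{l. R s l}. walks_from_to R \<theta> l)"
    by (cases w) (auto simp: walks_from_to_def image_iff split: if_splits)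
qed

lemma walks_from_to_coeff_0 [simp]: "gf_coeff (walks_from_to R \<theta> s) 0 x y = 0"
  by (rule gf_coeff_zero) (simp add: walks_from_to_def)

lemma walks_from_to_coeff_Suc:
  assumes "x \<noteq> 0" "y \<noteq> 0"
  shows "gf_coeff (walks_from_to R \<theta> s) (Suc n) x y =
    step_weight x y s *
       (of_bool (n = 0 \<and> s = \<theta>) + (\<Sum>l | R s l. gf_coeff (walks_from_to R \<theta> l) n x y))"
proof -
  define U where "U = (\<Union>l\<in>{l. R s l}. walks_from_to R \<theta> l)"
  have U: "gf_coeff U n x y = (\<Sum>l | R s l. gf_coeff (walks_from_to R \<theta> l) n x y)"
    unfolding U_def by (rule gf_coeff_UN_disjoint) (auto simp: walks_from_to_def)
  have U0: "gf_coeff U 0 x y = 0"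
    by (rule gf_coeff_zero) (auto simp: U_def walks_from_to_def)
  have "[\<theta>] \<notin> (#) s ` U"
    by (auto simp: U_def walks_from_to_def)
  then show ?thesis
    using assms unfolding walks_from_to_step[of R \<theta> s] U_def[symmetric]
    by
       (auto simp: gf_coeff_insert gf_coeff_Cons walk_weight_Cons U U0 distrib_left)
qed

lemma floored_subset: "floored_walks R \<theta> b s \<subseteq> walks_from_to R \<theta> s"
  by (auto simp: floored_walks_def walks_from_to_def)

section \<open>The last step of a half-plane walk\<close>

lemma H_walks_height_nonneg: "w \<in> H_walks R \<theta> \<Longrightarrow> 0 \<le> height w"
  by (auto simp: H_walks_def height_def dest: spec[of _ "length w"])

lemma H_walks_snoc:
  "w @ [s] \<in> H_walks R \<theta> \<longleftrightarrow>
    s = \<theta> \<and> 0 \<le> height w + rise \<theta> \<and> (w = [] \<or> (R (last w) s \<and> w \<in> H_walks R (last w)))"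
proof -
  have "(\<forall>k\<le>length (w @ [s]). 0 \<le> height (take k (w @ [s]))) \<longleftrightarrow>
     (\<forall>k\<le>length w. 0 \<le> height (take k w)) \<and> 0 \<le> height (w @ [s])"
    by (auto simp: le_Suc_eq)
  then show ?thesis
    by (cases "w = []") (auto simp: H_walks_def walk_snoc simp flip: height_def)
qed

lemma H_walks_last_step:
  "H_walks R \<theta> = (if \<theta> = South then {} else {[\<theta>]}) \<union>
     (\<lambda>w. w @ [\<theta>]) ` (\<Union>\<psi>\<in>{\<psi>. R \<psi> \<theta>}. {w \<in> H_walks R \<psi>. 0 \<le> height w + rise \<theta>})"
proof (intro set_eqI)
  fix w
  have rise: "0 \<le> rise \<theta> \<longleftrightarrow> \<theta> \<noteq> South"
    by (cases \<theta>) (auto simp: rise_def)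
  show "w \<in> H_walks R \<theta> \<longleftrightarrow> w \<in> (if \<theta> = South then {} else {[\<theta>]}) \<union>
     (\<lambda>w. w @ [\<theta>]) ` (\<Union>\<psi>\<in>{\<psi>. R \<psi> \<theta>}. {w \<in> H_walks R \<psi>. 0 \<le> height w + rise \<theta>})"
  proof (cases w rule: rev_cases)
    case Nil
    then show ?thesis by (auto simp: H_walks_def)
  next
    case (snoc u s)
    have "u @ [s] \<in> (\<lambda>w. w @ [\<theta>]) ` (\<Union>\<psi>\<in>{\<psi>. R \<psi> \<theta>}. {w \<in> H_walks R \<psi>. 0 \<le> height w + rise \<theta>}) \<longleftrightarrow>
      s = \<theta> \<and> (\<exists>\<psi>. R \<psi> \<theta> \<and> u \<in> H_walks R \<psi> \<and> 0 \<le> height u + rise \<theta>)"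
      by auto
    also have "\<dots> \<longleftrightarrow> s = \<theta> \<and> u \<noteq> [] \<and> R (last u) \<theta> \<and> u \<in> H_walks R (last u) \<and> 0 \<le> height u + rise \<theta>"
      by (auto simp: H_walks_def)
    finally show ?thesis
      unfolding snoc using rise by (cases "u = []") (auto simp: H_walks_snoc H_walks_snoc[of "[]", simplified])
  qed
qed

lemma H_coeff_0 [simp]: "gf_coeff (H_walks R \<theta>) 0 x y = 0"
  by (rule gf_coeff_zero) (simp add: H_walks_def)

text \<open>
  At \<open>y = 0\<close> the convention \<open>0 powi 0 = 1\<close> selects the walks that end on the ground, whose weight does
  not involve \<open>y\<close>. They are thus counted by the same sum at every other value of \<open>y\<close>.
\<close>

lemma H_coeff_ground:
  "gf_coeff (H_walks R \<theta>) n x 0 = gf_coeff {w \<in> H_walks R \<theta>. height w = 0} n x y"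
proof -
  have "gf_coeff (H_walks R \<theta>) n x 0 =
    (\<Sum>w | w \<in> {w \<in> H_walks R \<theta>. height w = 0} \<and> length w = n. walk_weight x 0 w)"
    unfolding gf_coeff_eq
    by (rule sum.mono_neutral_right) (auto simp: walk_weight_def height_def)
  also have "\<dots> = gf_coeff {w \<in> H_walks R \<theta>. height w = 0} n x y"
    unfolding gf_coeff_eq by (rule sum.cong) (auto simp: walk_weight_def height_def)
  finally show ?thesis .
qed

text \<open>
  Only a south step can leave the half-plane, and only from the ground. The subtracted term is the weight of
  the walks that the unrestricted recursion would let through.
\<close>

lemma H_coeff_Suc:
  assumes "x \<noteq> 0" "y \<noteq> 0"
  shows "gf_coeff (H_walks R \<theta>) (Suc n) x y =
    step_weight x y \<theta> * (of_bool (n = 0) + (\<Sum>\<psi> | R \<psi> \<theta>. gf_coeff (H_walks R \<psi>) n x y)) -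
    (if \<theta> = South then step_weight x y South *
       (of_bool (n = 0) + (\<Sum>\<psi> | R \<psi> South. gf_coeff (H_walks R \<psi>) n x 0)) else 0)"
proof -
  let ?W = "\<lambda>\<psi>. {w \<in> H_walks R \<psi>. 0 \<le> height w + rise \<theta>}"
  define U where "U = (\<Union>\<psi>\<in>{\<psi>. R \<psi> \<theta>}. ?W \<psi>)"
  have U: "gf_coeff U n x y = (\<Sum>\<psi> | R \<psi> \<theta>. gf_coeff (?W \<psi>) n x y)"
    unfolding U_def by (rule gf_coeff_UN_disjoint) (auto simp: H_walks_def)
  have W: "gf_coeff (?W \<psi>) n x y =
      gf_coeff (H_walks R \<psi>) n x y - (if \<theta> = South then gf_coeff (H_walks R \<psi>) n x 0 else 0)" for \<psi>
  proof (cases "\<theta> = South")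
    case True
    have "H_walks R \<psi> = ?W \<psi> \<union> {w \<in> H_walks R \<psi>. height w = 0}"
      using True H_walks_height_nonneg[of _ R \<psi>] by (auto simp: rise_def) fastforce
    then have "gf_coeff (H_walks R \<psi>) n x y =
        gf_coeff (?W \<psi>) n x y + gf_coeff {w \<in> H_walks R \<psi>. height w = 0} n x y"
      using True by (subst gf_coeff_Un_disjoint[symmetric]) (auto simp: rise_def)
    then show ?thesis using True by (simp add: H_coeff_ground[of _ _ _ _ y])
  next
    case False
    then have "0 \<le> rise \<theta>" by (cases \<theta>) (auto simp: rise_def)
    then have "?W \<psi> = H_walks R \<psi>" using H_walks_height_nonneg[of _ R \<psi>] by fastforce
    then show ?thesis using False by simp
  qed
  have "[\<theta>] \<notin> (\<lambda>w. w @ [\<theta>]) ` U"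
    by (auto simp: U_def H_walks_def)
  then have "gf_coeff (H_walks R \<theta>) (Suc n) x y =
      (if \<theta> = South then 0 else of_bool (n = 0) * step_weight x y \<theta>) +
      step_weight x y \<theta> * gf_coeff U n x y"
    using assms unfolding H_walks_last_step[of R \<theta>] U_def[symmetric]
    by (auto simp: gf_coeff_insert gf_coeff_snoc walk_weight_Cons)
  then show ?thesis
    unfolding U W by (auto simp: sum_subtractf algebra_simps)
qed

section \<open>Reachability and Perron vectors\<close>

lemma sum_pos_iff:
  fixes f :: "'a \<Rightarrow> real"
  assumes "finite A" "\<And>i. 0 \<le> f i"
  shows "0 < sum f A \<longleftrightarrow> (\<exists>i\<in>A. 0 < f i)"
  using assms sum_nonneg_eq_0_iff[of A f] sum_nonneg[of A f] by (metis less_le)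

primrec reach :: "rule \<Rightarrow> nat \<Rightarrow> step \<Rightarrow> step \<Rightarrow> bool" where
  "reach R 0 s \<theta> \<longleftrightarrow> s = \<theta>"
| "reach R (Suc n) s \<theta> \<longleftrightarrow> (\<exists>l. R s l \<and> reach R n l \<theta>)"

text \<open>
  Nonnegativity is part of the induction: a sum of nonnegative terms is positive exactly if one of them is.
\<close>

lemma transfer_power_pos_iff:
  "(((**) (transfer_matrix R) ^^ n) (mat 1)) $ s $ \<theta> \<ge> 0 \<and>
   ((((**) (transfer_matrix R) ^^ n) (mat 1)) $ s $ \<theta> > 0 \<longleftrightarrow> reach R n s \<theta>)"
proof (induction n arbitrary: s)
  case 0
  then show ?case by (simp add: mat_def)
next
  case (Suc n)
  let ?M = "((**) (transfer_matrix R) ^^ n) (mat 1)"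
  have eq: "(((**) (transfer_matrix R) ^^ Suc n) (mat 1)) $ s $ \<theta> =
      (\<Sum>l\<in>UNIV. of_bool (R s l) * ?M $ l $ \<theta>)"
    by (simp add: matrix_matrix_mult_def transfer_matrix_def)
  have nn: "0 \<le> of_bool (R s l) * ?M $ l $ \<theta>" for l
    using Suc.IH[of l] by simp
  have "(0 < (\<Sum>l\<in>UNIV. of_bool (R s l) * ?M $ l $ \<theta>)) \<longleftrightarrow>
     (\<exists>l\<in>UNIV. 0 < of_bool (R s l) * ?M $ l $ \<theta>)"
    by (rule sum_pos_iff[OF _ nn]) simp
  also have "\<dots> \<longleftrightarrow> (\<exists>l. R s l \<and> reach R n l \<theta>)"
    using Suc.IH by (simp add: zero_less_mult_iff) (metis (full_types))
  finally show ?case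
    unfolding eq using sum_nonneg[of UNIV "\<lambda>l. of_bool (R s l) * ?M $ l $ \<theta>"] nn by simp
qed

lemma aperiodicE:
  assumes "aperiodic R"
  obtains k where "1 \<le> k" "\<And>s \<theta>. reach R k s \<theta>"
  using assms unfolding aperiodic_def using transfer_power_pos_iff[where R = R] by metis

text \<open>
  The vector \<open>\<omega>\<close> is a right eigenvector of the matrix with entries \<open>step_weight x y s\<close> for \<open>R s l\<close>. With the
  weight attached to the row, \<open>\<omega> s\<close> is up to scaling the total weight of long walks that begin with \<open>s\<close>.
\<close>

definition perron_pair :: "rule \<Rightarrow> real \<Rightarrow> real \<Rightarrow> real \<Rightarrow> (step \<Rightarrow> real) \<Rightarrow> bool" where
  "perron_pair R x y \<mu> \<omega> \<longleftrightarrow> 0 < \<mu> \<and> (\<forall>s. 0 < \<omega> s) \<and>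
     (\<forall>s. step_weight x y s * (\<Sum>l | R s l. \<omega> l) = \<mu> * \<omega> s)"

text \<open>
  Brouwer's theorem on the simplex yields a nonnegative eigenvector; since some power of the matrix is
  positive, its entries and its eigenvalue are positive.
\<close>

lemma perron_pair_exists:
  assumes "aperiodic R" "0 < x" "0 < y"
  obtains \<mu> \<omega> where "perron_pair R x y \<mu> \<omega>"
proof -
  define A where "A v s = step_weight x y s * (\<Sum>l | R s l. v $ l)" for v :: "real^step" and s
  \<comment> \<open>Normalizing \<open>v + A v\<close> instead of \<open>A v\<close> keeps the denominator positive on the whole simplex and
    has the same fixed points.\<close>
  define N where "N v = 1 + (\<Sum>s\<in>UNIV. A v s)" for v
  define f where "f v = (\<chi> s. (v $ s + A v s) / N v)" for v
  define S where "S = {v :: real^step. (\<forall>s. 0 \<le> v $ s) \<and> (\<Sum>s\<in>UNIV. v $ s) = 1}"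
  have wpos: "0 < step_weight x y s" for s
    using assms by (simp add: step_weight_pos)
  have A_nonneg: "0 \<le> A v s" if "v \<in> S" for v s
    using that wpos[of s] by (auto simp: A_def S_def intro!: mult_nonneg_nonneg sum_nonneg)
  have N_pos: "0 < N v" if "v \<in> S" for v
    unfolding N_def using A_nonneg[OF that] by (intro add_pos_nonneg sum_nonneg) auto
  have cont_A: "continuous_on T (\<lambda>v. A v s)" for T s
    unfolding A_def by (intro continuous_intros)
  have "compact S"
  proof (rule compact_eq_bounded_closed[THEN iffD2], intro conjI)
    have "norm v \<le> 1" if "v \<in> S" for v
    proof -
      have "norm v \<le> (\<Sum>s\<in>UNIV. \<bar>v $ s\<bar>)" by (rule norm_le_l1_cart)
      also have "\<dots> = 1" using that by (simp add: S_def)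
      finally show ?thesis .
    qed
    then show "bounded S" by (auto simp: bounded_iff)
    have S_eq: "S = (\<Inter>s. {v. 0 \<le> v $ s}) \<inter> {v. (\<Sum>s\<in>UNIV. v $ s) = 1}"
      by (auto simp: S_def)
    show "closed S"
      unfolding S_eq
      by (intro closed_Int closed_INT ballI closed_Collect_le closed_Collect_eq continuous_intros)
  qed
  moreover have "convex S"
    by (auto simp: convex_def S_def sum.distrib simp flip: sum_distrib_left)
  moreover have "axis South 1 \<in> S"
    by (auto simp: S_def axis_def)
  moreover have "continuous_on S f"
    unfolding f_def using N_pos
    by (intro continuous_on_vec_lambda continuous_on_divide continuous_on_add cont_A continuous_on_component continuous_on_id)
       (auto simp: N_def intro!: continuous_intros cont_A less_imp_neq[symmetric])
  moreover have "f v \<in> S" if "v \<in> S" for v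
    using that N_pos[OF that] A_nonneg[OF that]
    by (auto simp: S_def f_def N_def sum.distrib simp flip: sum_divide_distrib)
  ultimately obtain v where v: "v \<in> S" "f v = v"
    using brouwer[of S f] by blast
  define \<mu> where "\<mu> = N v - 1"
  have eig: "A v s = \<mu> * v $ s" for s
  proof -
    have "(v $ s + A v s) / N v = v $ s"
      using v(2) by (metis f_def vec_lambda_beta)
    then show ?thesis
      using N_pos[OF v(1)] by (simp add: \<mu>_def field_simps)
  qed
  have \<mu>_nonneg: "0 \<le> \<mu>"
    unfolding \<mu>_def N_def using A_nonneg[OF v(1)] by (simp add: sum_nonneg)
  have v_nonneg: "0 \<le> v $ s" for s
    using v(1) by (simp add: S_def)
  have "(\<Sum>s\<in>UNIV. v $ s) \<noteq> 0"
    using v(1) by (simp add: S_def)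
  then have "\<exists>j. v $ j \<noteq> 0"
    using sum.neutral[of UNIV "\<lambda>s. v $ s"] by blast
  then obtain j where j: "0 < v $ j"
    using v_nonneg by (metis order_less_le)
  have pos: "0 < \<mu> ^ n * v $ s" if "reach R n s j" for n s
    using that
  proof (induction n arbitrary: s)
    case 0
    then show ?case using j by simp
  next
    case (Suc n)
    then obtain l where l: "R s l" "0 < \<mu> ^ n * v $ l" by auto
    have "\<mu> ^ n * v $ l \<le> (\<Sum>l | R s l. \<mu> ^ n * v $ l)"
      using l \<mu>_nonneg v_nonneg by (intro member_le_sum) auto
    then have "0 < (\<Sum>l | R s l. \<mu> ^ n * v $ l)"
      using l by linarith
    then have "0 < step_weight x y s * (\<Sum>l | R s l. \<mu> ^ n * v $ l)"
      by (rule mult_pos_pos[OF wpos])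
    also have "\<dots> = \<mu> ^ n * A v s"
      by (simp add: A_def sum_distrib_left mult_ac)
    finally show ?case by (simp add: eig mult_ac)
  qed
  obtain k where k: "1 \<le> k" "\<And>s \<theta>. reach R k s \<theta>"
    using aperiodicE[OF assms(1)] by blast
  have pos': "0 < \<mu> ^ k * v $ s" for s
    using pos k by blast
  then have "0 < v $ s" for s
    using v_nonneg[of s] by (metis mult_zero_right order_less_le)
  moreover have "0 < \<mu>"
    using pos'[of j] \<mu>_nonneg k(1) by (cases "\<mu> = 0") (auto simp: power_0_left)
  ultimately show ?thesis
    using that[of \<mu> "\<lambda>s. v $ s"] eig by (simp add: perron_pair_def A_def)
qed

section \<open>Recurrence and the dominant singularity\<close>

lemma sums_strict_mono:
  fixes f g :: "nat \<Rightarrow> real"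
  assumes "f sums a" "g sums b" "\<And>n. f n \<le> g n" "f n < g n"
  shows "a < b"
proof -
  have "(\<lambda>n. g n - f n) sums (b - a)"
    using assms by (intro sums_diff)
  moreover have "0 < (\<Sum>n. g n - f n)"
    using assms calculation by (intro suminf_pos2[of _ n]) (auto simp: sums_iff)
  ultimately show ?thesis by (simp add: sums_iff)
qed

locale perron =
  fixes R :: rule and x y \<mu> :: real and \<omega> :: "step \<Rightarrow> real"
  assumes aper: "aperiodic R" and x_pos: "0 < x" and y_pos: "0 < y"
    and pair: "perron_pair R x y \<mu> \<omega>"
begin

lemma mu_pos: "0 < \<mu>" and omega_pos: "0 < \<omega> s"
  and eigen: "step_weight x y s * (\<Sum>l | R s l. \<omega> l) = \<mu> * \<omega> s"
  using pair by (auto simp: perron_pair_def)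

lemma wt_pos: "0 < step_weight x y s"
  using x_pos y_pos by (rule step_weight_pos)

text \<open>
  \<open>survival \<theta> n s / \<omega> s\<close> is the probability that the Markov chain attached to the Perron pair, started in
  \<open>s\<close>, avoids \<open>\<theta>\<close> during its first \<open>n\<close> states. The factor \<open>\<omega>\<close> is kept to avoid divisions.
\<close>

primrec survival :: "step \<Rightarrow> nat \<Rightarrow> step \<Rightarrow> real" where
  "survival \<theta> 0 s = \<omega> s"
| "survival \<theta> (Suc n) s = (if s = \<theta> then 0 else step_weight x y s / \<mu> * (\<Sum>l | R s l. survival \<theta> n l))"

lemma survival_nonneg: "0 \<le> survival \<theta> n s"
proof (induction n arbitrary: s)
  case (Suc n)
  then have "0 \<le> step_weight x y s / \<mu> * (\<Sum>l | R s l. survival \<theta> n l)"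
    using less_imp_le[OF wt_pos[of s]] mu_pos by (intro mult_nonneg_nonneg sum_nonneg divide_nonneg_pos) auto
  then show ?case by simp
qed (use omega_pos less_imp_le in auto)

text \<open>
  The mass lost at time \<open>n\<close> is that of the walks whose first visit to \<open>\<theta>\<close> is their step number \<open>Suc n\<close>.
\<close>

lemma survival_diff:
  "survival \<theta> n s - survival \<theta> (Suc n) s =
     \<omega> \<theta> * \<mu> / step_weight x y \<theta> * (gf_coeff (passage_walks R \<theta> s) (Suc n) x y * (1 / \<mu>) ^ Suc n)"
proof (induction n arbitrary: s)
  case 0
  have "step_weight x y s / \<mu> * (\<Sum>l | R s l. \<omega> l) = \<omega> s"
    using eigen[of s] mu_pos by simp
  then show ?case
    using wt_pos[of \<theta>] mu_pos x_pos y_pos by (simp add: passage_coeff_Suc)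
next
  case (Suc n)
  let ?c = "\<omega> \<theta> * \<mu> / step_weight x y \<theta>"
  show ?case
  proof (cases "s = \<theta>")
    case True
    then show ?thesis using x_pos y_pos by (simp add: passage_coeff_Suc)
  next
    case False
    have "survival \<theta> (Suc n) s - survival \<theta> (Suc (Suc n)) s =
      step_weight x y s / \<mu> * (\<Sum>l | R s l. survival \<theta> n l - survival \<theta> (Suc n) l)"
      using False unfolding survival.simps(2)[of \<theta> _ s] by (simp add: sum_subtractf right_diff_distrib del: survival.simps)
    also have "\<dots> = ?c * (step_weight x y s * (\<Sum>l | R s l. gf_coeff (passage_walks R \<theta> l) (Suc n) x y)
        * (1 / \<mu>) ^ Suc (Suc n))"
      unfolding Suc.IH using mu_pos by (simp add: sum_distrib_left sum_distrib_right sum_divide_distrib mult_ac)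
    also have "\<dots> = ?c * (gf_coeff (passage_walks R \<theta> s) (Suc (Suc n)) x y * (1 / \<mu>) ^ Suc (Suc n))"
      using False x_pos y_pos by (simp add: passage_coeff_Suc[of x y R \<theta> s "Suc n"])
    finally show ?thesis .
  qed
qed

lemma survival_le: "survival \<theta> n s \<le> \<omega> s"
proof (induction n arbitrary: s)
  case (Suc n)
  have "step_weight x y s / \<mu> * (\<Sum>l | R s l. survival \<theta> n l) \<le> step_weight x y s / \<mu> * (\<Sum>l | R s l. \<omega> l)"
    using Suc wt_pos[of s] mu_pos by (intro mult_left_mono sum_mono) auto
  also have "\<dots> = \<omega> s" using eigen[of s] mu_pos by simp
  finally show ?case using omega_pos[of \<theta>] by simp
qed simp

text \<open>
  A walk from \<open>s\<close> to \<open>\<theta>\<close> carries a positive share of the mass \<open>\<omega> s\<close>.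
\<close>

lemma survival_less: "reach R n s \<theta> \<Longrightarrow> survival \<theta> (Suc n) s < \<omega> s"
proof (induction n arbitrary: s)
  case 0
  then show ?case using omega_pos by simp
next
  case (Suc n)
  then obtain l where l: "R s l" "survival \<theta> (Suc n) l < \<omega> l" by auto
  then have "(\<Sum>l | R s l. survival \<theta> (Suc n) l) < (\<Sum>l | R s l. \<omega> l)"
    by (intro sum_strict_mono_ex1) (auto simp: survival_le simp del: survival.simps)
  then have "step_weight x y s / \<mu> * (\<Sum>l | R s l. survival \<theta> (Suc n) l) < step_weight x y s / \<mu> * (\<Sum>l | R s l. \<omega> l)"
    using wt_pos[of s] mu_pos by (intro mult_strict_left_mono) auto
  also have "\<dots> = \<omega> s" using eigen[of s] mu_pos by simp
  finally show ?case
    using omega_pos[of \<theta>] unfolding survival.simps(2)[of \<theta> "Suc n" s]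
    by (simp del: survival.simps)
qed

text \<open>
  Let \<open>k\<close> be such that \<open>\<theta>\<close> is reachable from everywhere in \<open>k\<close> steps. The sum \<open>\<omega>'\<close> of the first \<open>Suc k\<close>
  survival vectors loses \<open>survival \<theta> 0 - survival \<theta> (Suc k) > 0\<close> in one step, so it is multiplied by some
  \<open>\<kappa> < 1\<close> at most, and it dominates \<open>\<omega>\<close>.
\<close>

lemma survival_decay:
  obtains \<kappa> K where "0 < \<kappa>" "\<kappa> < 1" "0 < K" "\<And>n s. survival \<theta> n s \<le> K * \<kappa> ^ n"
proof -
  obtain k where k: "\<And>s. reach R k s \<theta>" using aperiodicE[OF aper] by metis
  define \<omega>' where "\<omega>' s = (\<Sum>m\<le>k. survival \<theta> m s)" for s
  define L where "L s = (\<Sum>m\<le>k. survival \<theta> (Suc m) s)" for s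
  have \<omega>'_ge: "\<omega> s \<le> \<omega>' s" for s
    unfolding \<omega>'_def using member_le_sum[of 0 "{..k}" "\<lambda>m. survival \<theta> m s"] survival_nonneg by simp
  have \<omega>'_pos: "0 < \<omega>' s" for s
    using \<omega>'_ge[of s] omega_pos[of s] by linarith
  have "L s < \<omega>' s" for s
  proof -
    have "\<omega>' s - L s = survival \<theta> 0 s - survival \<theta> (Suc k) s"
      unfolding \<omega>'_def L_def by (subst sum_telescope[symmetric]) (simp add: sum_subtractf del: survival.simps)
    then show ?thesis using survival_less[OF k, of s] by (simp del: survival.simps(2))
  qed
  then have ratio: "L s / \<omega>' s < 1" for s
    using \<omega>'_pos[of s] by simp
  \<comment> \<open>The value 1/2 only keeps \<open>\<kappa>\<close> positive, so that it can be divided by.\<close>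
  define \<kappa> where "\<kappa> = Max (insert (1 / 2) (range (\<lambda>s. L s / \<omega>' s)))"
  have \<kappa>: "0 < \<kappa>" "\<kappa> < 1"
    unfolding \<kappa>_def using ratio by (auto simp: Max_gr_iff intro!: exI[of _ "1/2"])
  have L_le: "L s \<le> \<kappa> * \<omega>' s" for s
  proof -
    have "L s / \<omega>' s \<le> \<kappa>" unfolding \<kappa>_def by (rule Max_ge) auto
    then show ?thesis using \<omega>'_pos[of s] by (simp add: field_simps)
  qed
  have step: "step_weight x y s / \<mu> * (\<Sum>l | R s l. \<omega>' l) = L s" if "s \<noteq> \<theta>" for s
    unfolding \<omega>'_def L_def using that by (subst sum.swap) (simp add: sum_distrib_left)
  have main: "survival \<theta> n s \<le> \<kappa> ^ n * \<omega>' s" for n s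
  proof (induction n arbitrary: s)
    case 0
    then show ?case using \<omega>'_ge by simp
  next
    case (Suc n)
    show ?case
    proof (cases "s = \<theta>")
      case True
      then show ?thesis using \<kappa> \<omega>'_pos[of s] by simp
    next
      case False
      have "step_weight x y s / \<mu> * (\<Sum>l | R s l. survival \<theta> n l) \<le>
          step_weight x y s / \<mu> * (\<Sum>l | R s l. \<kappa> ^ n * \<omega>' l)"
        using Suc wt_pos[of s] mu_pos by (intro mult_left_mono sum_mono) auto
      then have "survival \<theta> (Suc n) s \<le> step_weight x y s / \<mu> * (\<Sum>l | R s l. \<kappa> ^ n * \<omega>' l)"
        using False by simp
      also have "\<dots> = \<kappa> ^ n * L s"
        unfolding step[OF False, symmetric] sum_distrib_left[symmetric] by simp
      also have "\<dots> \<le> \<kappa> ^ n * (\<kappa> * \<omega>' s)"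
        using L_le \<kappa> by (intro mult_left_mono) auto
      finally show ?thesis by (simp add: mult_ac)
    qed
  qed
  define K where "K = Max (range \<omega>')"
  have "\<omega>' s \<le> K" for s unfolding K_def by simp
  then have "survival \<theta> n s \<le> K * \<kappa> ^ n" for n s
    using main[of n s] \<kappa> by (smt (verit, best) mult.commute mult_right_mono zero_le_power)
  moreover have "0 < K" using \<open>\<And>s. \<omega>' s \<le> K\<close>[of South] \<omega>'_pos[of South] by linarith
  ultimately show ?thesis using that \<kappa> by blast
qed

lemma passage_decay:
  obtains \<kappa> K where "0 < \<kappa>" "\<kappa> < 1" "0 < K"
    "\<And>n s. gf_coeff (passage_walks R \<theta> s) n x y \<le> K * (\<kappa> * \<mu>) ^ n"
proof -
  obtain \<kappa> K where \<kappa>: "0 < \<kappa>" "\<kappa> < 1" "0 < K" "\<And>n s. survival \<theta> n s \<le> K * \<kappa> ^ n"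
    using survival_decay[of \<theta>] by blast
  define c where "c = \<omega> \<theta> * \<mu> / step_weight x y \<theta>"
  have c: "0 < c" unfolding c_def using omega_pos mu_pos wt_pos by simp
  have "gf_coeff (passage_walks R \<theta> s) n x y \<le> K / (c * \<kappa>) * (\<kappa> * \<mu>) ^ n" for n s
  proof (cases n)
    case 0
    then show ?thesis using c \<kappa> by simp
  next
    case (Suc m)
    have "c * (gf_coeff (passage_walks R \<theta> s) n x y * (1 / \<mu>) ^ n) \<le> K * \<kappa> ^ m"
      using survival_diff[of \<theta> m s] \<kappa>(4)[of m s] survival_nonneg[of \<theta> "Suc m" s] unfolding Suc c_def
      by (simp del: survival.simps)
    then show ?thesis
      using c \<kappa> mu_pos unfolding Suc by (simp add: field_simps power_mult_distrib)
  qed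
  moreover have "0 < K / (c * \<kappa>)" using c \<kappa> by simp
  ultimately show ?thesis using that \<kappa> by blast
qed

text \<open>
  By \<open>survival_diff\<close> the series telescopes, and survival tends to zero.
\<close>

lemma passage_sums:
  "(\<lambda>n. gf_coeff (passage_walks R \<theta> s) n x y * (1 / \<mu>) ^ n) sums
     (step_weight x y \<theta> / (\<mu> * \<omega> \<theta>) * \<omega> s)"
proof -
  obtain \<kappa> K where \<kappa>: "0 < \<kappa>" "\<kappa> < 1" "0 < K" "\<And>n s. survival \<theta> n s \<le> K * \<kappa> ^ n"
    using survival_decay[of \<theta>] by blast
  have "(\<lambda>n. K * \<kappa> ^ n) \<longlonglongrightarrow> K * 0"
    using \<kappa> by (intro tendsto_mult_left LIMSEQ_power_zero) auto
  then have "(\<lambda>n. survival \<theta> n s) \<longlonglongrightarrow> 0"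
    by (intro tendsto_sandwich[of "\<lambda>_. 0" "\<lambda>n. survival \<theta> n s" _ "\<lambda>n. K * \<kappa> ^ n"]
          always_eventually allI survival_nonneg \<kappa>(4)) simp_all
  then have "(\<lambda>n. survival \<theta> n s - survival \<theta> (Suc n) s) sums (survival \<theta> 0 s - 0)"
    by (rule telescope_sums')
  then have "(\<lambda>n. \<omega> \<theta> * \<mu> / step_weight x y \<theta> * (gf_coeff (passage_walks R \<theta> s) (Suc n) x y * (1 / \<mu>) ^ Suc n)) sums \<omega> s"
    unfolding survival_diff by simp
  from sums_mult[OF this, of "step_weight x y \<theta> / (\<mu> * \<omega> \<theta>)"]
  have "(\<lambda>n. gf_coeff (passage_walks R \<theta> s) (Suc n) x y * (1 / \<mu>) ^ Suc n) sums (step_weight x y \<theta> / (\<mu> * \<omega> \<theta>) * \<omega> s)"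
    using omega_pos[of \<theta>] mu_pos wt_pos[of \<theta>] by (simp add: field_simps)
  then show ?thesis by (subst (asm) sums_Suc_iff) simp
qed

lemma B_sums_1: "(\<lambda>n. gf_coeff (B_walks R \<theta>) n x y * (1 / \<mu>) ^ n) sums 1"
proof -
  have "(\<lambda>n. \<Sum>s | R \<theta> s. gf_coeff (passage_walks R \<theta> s) n x y * (1 / \<mu>) ^ n) sums
     (\<Sum>s | R \<theta> s. step_weight x y \<theta> / (\<mu> * \<omega> \<theta>) * \<omega> s)"
    by (intro sums_sum passage_sums)
  also have "(\<Sum>s | R \<theta> s. step_weight x y \<theta> / (\<mu> * \<omega> \<theta>) * \<omega> s) =
     (step_weight x y \<theta> * (\<Sum>s | R \<theta> s. \<omega> s)) / (\<mu> * \<omega> \<theta>)"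
    by (simp add: sum_distrib_left sum_divide_distrib)
  also have "\<dots> = 1"
    unfolding eigen using mu_pos omega_pos[of \<theta>] by simp
  finally show ?thesis by (simp add: B_coeff sum_distrib_right)
qed

lemma B_decay:
  obtains \<kappa> K where "0 < \<kappa>" "\<kappa> < 1" "0 < K"
    "\<And>n. gf_coeff (B_walks R \<theta>) n x y \<le> K * (\<kappa> * \<mu>) ^ n"
proof -
  obtain \<kappa> K where \<kappa>: "0 < \<kappa>" "\<kappa> < 1" "0 < K"
    "\<And>n s. gf_coeff (passage_walks R \<theta> s) n x y \<le> K * (\<kappa> * \<mu>) ^ n"
    using passage_decay[of \<theta>] by blast
  define N where "N = card {s. R \<theta> s}"
  have "gf_coeff (B_walks R \<theta>) n x y \<le> (real N + 1) * K * (\<kappa> * \<mu>) ^ n" for n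
  proof -
    have "gf_coeff (B_walks R \<theta>) n x y \<le> real N * (K * (\<kappa> * \<mu>) ^ n)"
      unfolding B_coeff N_def by (rule sum_bounded_above) (use \<kappa> in auto)
    also have "\<dots> \<le> (real N + 1) * (K * (\<kappa> * \<mu>) ^ n)"
      using \<kappa> mu_pos by (intro mult_right_mono) auto
    finally show ?thesis by simp
  qed
  moreover have "0 < (real N + 1) * K" using \<kappa> by simp
  ultimately show ?thesis using that \<kappa> by blast
qed

lemma B_coeff_0 [simp]: "gf_coeff (B_walks R \<theta>) 0 u v = 0"
  by (simp add: B_coeff)

lemma B_coeff_nonneg: "0 \<le> gf_coeff (B_walks R \<theta>) n x y"
  using x_pos y_pos by (simp add: gf_coeff_nonneg)

text \<open>
  The coefficients are nonnegative and not all zero, so the series is strictly increasing in \<open>t > 0\<close>.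
\<close>

lemma B_root_ge:
  assumes "0 < t" "(\<lambda>n. gf_coeff (B_walks R \<theta>) n x y * t ^ n) sums S" "1 \<le> S"
  shows "1 / \<mu> \<le> t"
proof (rule ccontr)
  assume "\<not> 1 / \<mu> \<le> t"
  then have t: "t < 1 / \<mu>" by simp
  let ?b = "\<lambda>n. gf_coeff (B_walks R \<theta>) n x y"
  have le: "?b n * t ^ n \<le> ?b n * (1 / \<mu>) ^ n" for n
    using t assms(1) by (intro mult_left_mono power_mono B_coeff_nonneg) auto
  have "\<exists>n. ?b n \<noteq> 0"
  proof (rule ccontr)
    assume "\<not> ?thesis"
    then have "(\<lambda>n. ?b n * (1 / \<mu>) ^ n) sums 0" by simp
    from sums_unique2[OF this B_sums_1] show False by simp
  qed
  then obtain n where n: "0 < ?b n" using B_coeff_nonneg[of \<theta>] by (metis less_le)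
  then have "n \<noteq> 0" by (intro notI) simp
  then have "?b n * t ^ n < ?b n * (1 / \<mu>) ^ n"
    using n t assms(1) by (intro mult_strict_left_mono power_strict_mono) auto
  then have "S < 1"
    using le by (intro sums_strict_mono[OF assms(2) B_sums_1])
  then show False using assms(3) by simp
qed

lemma smallest_root: "is_smallest_root R \<theta> x y (1 / \<mu>)"
  unfolding is_smallest_root_def using mu_pos B_sums_1[of \<theta>] B_root_ge[of _ \<theta> 1] by auto

lemma rho_eq: "rho R x y = 1 / \<mu>"
  unfolding rho_def
proof (rule the_equality)
  show "\<forall>\<theta>. is_smallest_root R \<theta> x y (1 / \<mu>)" using smallest_root by blast
  fix t assume t: "\<forall>\<theta>. is_smallest_root R \<theta> x y t"
  show "t = 1 / \<mu>"
    using t smallest_root unfolding is_smallest_root_def by (meson order_antisym)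
qed

lemma passage_coeff_nonneg: "0 \<le> gf_coeff (passage_walks R \<theta> s) n x y"
  using x_pos y_pos by (simp add: gf_coeff_nonneg)

section \<open>Aperiodicity and the circle of convergence\<close>

text \<open>
  The walk is cut at its first visit to \<open>\<theta>\<close>.
\<close>

lemma reach_first_passage:
  "reach R n s \<theta> \<Longrightarrow>
     \<exists>m\<le>n. 0 < gf_coeff (passage_walks R \<theta> s) (Suc m) x y \<and> reach R (n - m) \<theta> \<theta>"
proof (induction n arbitrary: s)
  case 0
  then show ?case using wt_pos x_pos y_pos by (simp add: passage_coeff_Suc)
next
  case (Suc n)
  show ?case
  proof (cases "s = \<theta>")
    case True
    then show ?thesis
      using Suc.prems wt_pos x_pos y_pos by (intro exI[of _ 0]) (simp add: passage_coeff_Suc)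
  next
    case False
    from Suc.prems obtain l where Rl: "R s l" "reach R n l \<theta>"
      by auto
    with Suc.IH obtain m where l: "R s l" "m \<le> n"
      "0 < gf_coeff (passage_walks R \<theta> l) (Suc m) x y" "reach R (n - m) \<theta> \<theta>"
      by blast
    have "0 < (\<Sum>l | R s l. gf_coeff (passage_walks R \<theta> l) (Suc m) x y)"
      using l passage_coeff_nonneg by (subst sum_pos_iff) auto
    then have "0 < gf_coeff (passage_walks R \<theta> s) (Suc (Suc m)) x y"
      using False x_pos y_pos wt_pos[of s] by (simp add: passage_coeff_Suc[of _ _ _ _ _ "Suc m"])
    then show ?thesis
      using l by (intro exI[of _ "Suc m"]) auto
  qed
qed

text \<open>
  Every loop at \<open>\<theta>\<close> is a concatenation of first returns.
\<close>

lemma loop_root_of_unity: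
  fixes z :: complex
  assumes "\<And>m. 0 < gf_coeff (B_walks R \<theta>) m x y \<Longrightarrow> z ^ m = 1"
  shows "reach R n \<theta> \<theta> \<Longrightarrow> z ^ n = 1"
proof (induction n rule: less_induct)
  case (less n)
  show ?case
  proof (cases n)
    case (Suc k)
    with less.prems obtain l where l: "R \<theta> l" "reach R k l \<theta>" by auto
    then obtain m where m: "m \<le> k" "0 < gf_coeff (passage_walks R \<theta> l) (Suc m) x y"
        "reach R (k - m) \<theta> \<theta>"
      using reach_first_passage by blast
    have "0 < gf_coeff (B_walks R \<theta>) (Suc m) x y"
      unfolding B_coeff using l m passage_coeff_nonneg by (subst sum_pos_iff) auto
    then have "z ^ Suc m = 1" by (rule assms)
    moreover have "z ^ (k - m) = 1" using less.IH[of "k - m"] m Suc by simp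
    moreover have "n = Suc m + (k - m)" using Suc m by simp
    ultimately show ?thesis by (metis mult_1 power_add)
  qed simp
qed

text \<open>
  Aperiodicity supplies loops at \<open>\<theta>\<close> of two consecutive lengths.
\<close>

lemma aperiodic_root_of_unity:
  fixes z :: complex
  assumes "\<And>m. 0 < gf_coeff (B_walks R \<theta>) m x y \<Longrightarrow> z ^ m = 1"
  shows "z = 1"
proof -
  obtain k where k: "1 \<le> k" "\<And>s \<theta>. reach R k s \<theta>" using aperiodicE[OF aper] by blast
  obtain l where "R \<theta> l" using k(1) k(2)[of \<theta> \<theta>] by (cases k) auto
  then have "reach R (Suc k) \<theta> \<theta>" using k(2) by auto
  then have "z ^ Suc k = 1" "z ^ k = 1"
    using loop_root_of_unity[OF assms] k(2) by blast+
  then show ?thesis by simp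
qed

text \<open>
  With \<open>t = z / \<mu>\<close>, the value 1 is an average of the numbers \<open>z ^ n\<close> of the closed unit disc with
  weights summing to 1. So \<open>z ^ n = 1\<close> for every return time \<open>n\<close>.
\<close>

lemma B_unique_root:
  fixes t :: complex
  assumes t: "norm t \<le> 1 / \<mu>"
    and sum: "(\<lambda>n. of_real (gf_coeff (B_walks R \<theta>) n x y) * t ^ n) sums 1"
  shows "t = of_real (1 / \<mu>)"
proof -
  define z where "z = of_real \<mu> * t"
  let ?b = "\<lambda>n. gf_coeff (B_walks R \<theta>) n x y * (1 / \<mu>) ^ n"
  have t_eq: "t = of_real (1 / \<mu>) * z" using mu_pos by (simp add: z_def)
  have z: "norm (z ^ n) \<le> 1" for n
    using t mu_pos unfolding norm_power z_def norm_mult by (intro power_le_one) (auto simp: field_simps)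
  have term_eq: "of_real (gf_coeff (B_walks R \<theta>) n x y) * t ^ n = of_real (?b n) * z ^ n" for n
    by (simp add: t_eq power_mult_distrib power_divide)
  have "(\<lambda>n. Re (of_real (?b n) * z ^ n)) sums Re 1"
    using sums_Re[OF sum] unfolding term_eq .
  then have Re: "(\<lambda>n. ?b n * Re (z ^ n)) sums 1" by simp
  have b: "0 \<le> ?b n" for n using B_coeff_nonneg mu_pos by simp
  have Re_le: "Re (z ^ n) \<le> 1" for n
    using complex_Re_le_cmod[of "z ^ n"] z[of n] by linarith
  have "z ^ m = 1" if m: "0 < gf_coeff (B_walks R \<theta>) m x y" for m
  proof -
    have "\<not> Re (z ^ m) < 1"
    proof
      assume "Re (z ^ m) < 1"
      then have "?b m * Re (z ^ m) < ?b m" using m mu_pos by simp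
      moreover have "?b n * Re (z ^ n) \<le> ?b n" for n
        using mult_left_mono[OF Re_le b, of n n] by simp
      ultimately show False using sums_strict_mono[OF Re B_sums_1[of \<theta>], of m] by simp
    qed
    then have Re1: "Re (z ^ m) = 1" using Re_le[of m] by simp
    have "norm (z ^ m) ^ 2 \<le> 1" using z[of m] by (simp add: power_le_one)
    then have "Im (z ^ m) = 0" using Re1 by (simp add: cmod_power2)
    then show ?thesis using Re1 by (simp add: complex_eq_iff)
  qed
  then have "z = 1" by (rule aperiodic_root_of_unity)
  then show ?thesis by (simp add: t_eq)
qed

end

section \<open>The kernel equation\<close>

definition gf_fps :: "step list set \<Rightarrow> real \<Rightarrow> real \<Rightarrow> complex fps" where
  "gf_fps W x y = Abs_fps (\<lambda>n. of_real (gf_coeff W n x y))"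

lemma fps_nth_gf_fps [simp]: "fps_nth (gf_fps W x y) n = of_real (gf_coeff W n x y)"
  by (simp add: gf_fps_def)

lemma passage_fps:
  assumes "x \<noteq> 0" "y \<noteq> 0"
  shows "gf_fps (passage_walks R \<theta> s) x y = fps_X * fps_const (of_real (step_weight x y s)) *
    (if s = \<theta> then 1 else \<Sum>l | R s l. gf_fps (passage_walks R \<theta> l) x y)"
proof (rule fps_ext)
  fix n show "fps_nth (gf_fps (passage_walks R \<theta> s) x y) n =
    fps_nth (fps_X * fps_const (of_real (step_weight x y s)) *
    (if s = \<theta> then 1 else \<Sum>l | R s l. gf_fps (passage_walks R \<theta> l) x y)) n"
    using assms by (cases n) (auto simp: passage_coeff_Suc mult.assoc fps_sum_nth)
qed

lemma H_fps:
  assumes "x \<noteq> 0" "y \<noteq> 0"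
  shows "gf_fps (H_walks R \<theta>) x y =
    fps_X * fps_const (of_real (step_weight x y \<theta>)) * (1 + (\<Sum>\<psi> | R \<psi> \<theta>. gf_fps (H_walks R \<psi>) x y)) -
    (if \<theta> = South then fps_X * fps_const (of_real (step_weight x y South)) *
      (1 + (\<Sum>\<psi> | R \<psi> South. gf_fps (H_walks R \<psi>) x 0)) else 0)"
    (is "_ = ?rhs")
proof (rule fps_ext)
  fix n show "fps_nth (gf_fps (H_walks R \<theta>) x y) n = fps_nth ?rhs n"
    using assms by (cases n) (auto simp: H_coeff_Suc mult.assoc fps_sum_nth)
qed

text \<open>
  Let \<open>g s\<close> be 1 for \<open>s = \<theta>\<close> and otherwise the generating function of the continuations from \<open>s\<close> up to
  the first visit to \<open>\<theta>\<close>, and let \<open>c s\<close> be the weight of the step \<open>s\<close> times \<open>t\<close>. The first-passage series are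
  \<open>P s = c s * g s\<close>. Multiplying the last-step equation for \<open>H s\<close> by \<open>g s\<close> and summing over \<open>s\<close>, all terms with
  \<open>s \<noteq> \<theta>\<close> cancel.
\<close>

lemma kernel_equation:
  assumes "x \<noteq> 0" "y \<noteq> 0"
  shows "gf_fps (H_walks R \<theta>) x y * (1 - gf_fps (B_walks R \<theta>) x y) =
    gf_fps (C_walks R \<theta>) x y -
    gf_fps (D_walks R \<theta>) x y * (\<Sum>\<phi> | R \<phi> South. gf_fps (H_walks R \<phi>) x 0)"
proof -
  define P where "P s = gf_fps (passage_walks R \<theta> s) x y" for s
  define H where "H s = gf_fps (H_walks R s) x y" for s
  define G where "G = (\<Sum>\<phi> | R \<phi> South. gf_fps (H_walks R \<phi>) x 0)"
  define c where "c s = fps_X * fps_const (complex_of_real (step_weight x y s))" for s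
  define g where "g s = (if s = \<theta> then 1 else \<Sum>l | R s l. P l)" for s
  have B: "gf_fps (B_walks R \<theta>) x y = (\<Sum>s | R \<theta> s. P s)"
    by (rule fps_ext) (simp add: P_def B_coeff fps_sum_nth)
  have C: "gf_fps (C_walks R \<theta>) x y = (\<Sum>s\<in>UNIV - {South}. P s)"
    by (rule fps_ext) (simp add: P_def C_coeff fps_sum_nth)
  have D: "gf_fps (D_walks R \<theta>) x y = P South"
    by (simp add: P_def D_walks_eq)
  have P: "P s = c s * g s" for s
    unfolding P_def c_def g_def by (rule passage_fps[OF assms])
  have H: "H s = c s * (1 + (\<Sum>l | R l s. H l)) - (if s = South then c South * (1 + G) else 0)" for s
    unfolding H_def c_def G_def by (rule H_fps[OF assms])
  have "(\<Sum>s\<in>UNIV. H s * g s) =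
      (\<Sum>s\<in>UNIV. (P s + (\<Sum>l | R l s. H l * P s)) - (if s = South then P South * (1 + G) else 0))"
  proof (rule sum.cong)
    fix s
    have "H s * g s = c s * g s + (\<Sum>l | R l s. H l) * (c s * g s) -
        (if s = South then c South * g South * (1 + G) else 0)"
      by (subst H) (simp add: algebra_simps)
    then show "H s * g s = (P s + (\<Sum>l | R l s. H l * P s)) - (if s = South then P South * (1 + G) else 0)"
      by (simp add: P sum_distrib_right)
  qed simp
  also have "\<dots> = (\<Sum>s\<in>UNIV. P s) + (\<Sum>s\<in>UNIV. \<Sum>l | R l s. H l * P s) - P South * (1 + G)"
    by (simp add: sum.distrib sum_subtractf)
  also have "(\<Sum>s\<in>UNIV. \<Sum>l | R l s. H l * P s) = (\<Sum>l\<in>UNIV. \<Sum>s | R l s. H l * P s)"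
    using sum.swap_restrict[of UNIV UNIV "\<lambda>s l. H l * P s" "\<lambda>s l. R l s"] by simp
  also have "\<dots> = (\<Sum>l\<in>UNIV. H l * (\<Sum>s | R l s. P s))"
    by (simp add: sum_distrib_left)
  finally have "(\<Sum>s\<in>UNIV. H s * g s) - (\<Sum>s\<in>UNIV. H s * (\<Sum>l | R s l. P l)) =
      (\<Sum>s\<in>UNIV. P s) - P South * (1 + G)"
    by simp
  moreover have "(\<Sum>s\<in>UNIV. H s * g s) - (\<Sum>s\<in>UNIV. H s * (\<Sum>l | R s l. P l)) =
      (\<Sum>s\<in>UNIV. if s = \<theta> then H \<theta> * (1 - (\<Sum>l | R \<theta> l. P l)) else 0)"
    unfolding sum_subtractf[symmetric] by (rule sum.cong) (auto simp: g_def algebra_simps)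
  moreover have "(\<Sum>s\<in>UNIV. P s) = P South + (\<Sum>s\<in>UNIV - {South}. P s)"
    by (rule sum.remove) auto
  ultimately show ?thesis
    unfolding B C D G_def[symmetric] H_def[symmetric] by (simp add: algebra_simps)
qed

section \<open>Growth of half-plane walks\<close>

context perron begin

lemma walks_upper:
  "gf_coeff (walks_from_to R \<theta> s) n x y \<le> step_weight x y \<theta> / (\<mu> * \<omega> \<theta>) * \<mu> ^ n * \<omega> s"
proof (induction n arbitrary: s)
  case 0
  then show ?case
    using less_imp_le[OF wt_pos[of \<theta>]] less_imp_le[OF omega_pos] mu_pos by simp
next
  case (Suc n)
  let ?c = "step_weight x y \<theta> / (\<mu> * \<omega> \<theta>)"
  have c: "0 < ?c" using wt_pos omega_pos mu_pos by simp
  show ?case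
  proof (cases "n = 0")
    case True
    then show ?thesis
      using x_pos y_pos mu_pos omega_pos[of s] omega_pos[of \<theta>] wt_pos[of \<theta>]
      by (cases "s = \<theta>") (simp_all add: walks_from_to_coeff_Suc)
  next
    case False
    have "step_weight x y s * (\<Sum>l | R s l. gf_coeff (walks_from_to R \<theta> l) n x y) \<le>
        step_weight x y s * (\<Sum>l | R s l. ?c * \<mu> ^ n * \<omega> l)"
      using less_imp_le[OF wt_pos] by (intro mult_left_mono sum_mono Suc.IH) auto
    also have "\<dots> = ?c * \<mu> ^ n * (step_weight x y s * (\<Sum>l | R s l. \<omega> l))"
      unfolding sum_distrib_left[symmetric] by simp
    also have "\<dots> = ?c * \<mu> ^ Suc n * \<omega> s"
      unfolding eigen by simp
    finally show ?thesis
      using False x_pos y_pos by (simp add: walks_from_to_coeff_Suc)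
  qed
qed

lemma H_upper: obtains K where "0 < K" "\<And>n. gf_coeff (H_walks R \<theta>) n x y \<le> K * \<mu> ^ n"
proof -
  define K where "K = (\<Sum>s\<in>UNIV. step_weight x y \<theta> / (\<mu> * \<omega> \<theta>) * \<omega> s)"
  have "gf_coeff (H_walks R \<theta>) n x y \<le> K * \<mu> ^ n" for n
  proof -
    have "gf_coeff (floored_walks R \<theta> 0 s) n x y \<le> step_weight x y \<theta> / (\<mu> * \<omega> \<theta>) * \<omega> s * \<mu> ^ n" for s
      using gf_coeff_mono[OF floored_subset, of x y R \<theta> 0 s n] walks_upper[of \<theta> s n] x_pos y_pos
      by (simp add: mult_ac)
    then show ?thesis
      unfolding H_coeff_floored K_def sum_distrib_right by (intro sum_mono)
  qed
  moreover have "0 < K"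
    unfolding K_def using wt_pos omega_pos mu_pos by (intro sum_pos) auto
  ultimately show ?thesis using that by blast
qed

lemma walks_pos:
  "reach R n s \<theta> \<Longrightarrow> 0 < gf_coeff (walks_from_to R \<theta> s) (Suc n) x y"
proof (induction n arbitrary: s)
  case 0
  then show ?case using wt_pos x_pos y_pos by (simp add: walks_from_to_coeff_Suc)
next
  case (Suc n)
  then obtain l where l: "R s l" "0 < gf_coeff (walks_from_to R \<theta> l) (Suc n) x y" by auto
  then have "0 < (\<Sum>l | R s l. gf_coeff (walks_from_to R \<theta> l) (Suc n) x y)"
    using x_pos y_pos by (subst sum_pos_iff) (auto simp: gf_coeff_nonneg)
  then show ?case
    using wt_pos x_pos y_pos by (simp add: walks_from_to_coeff_Suc[of _ _ _ _ _ "Suc n"])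
qed

lemma walks_lower:
  obtains \<epsilon> N where "0 < \<epsilon>" "\<And>n s. N \<le> n \<Longrightarrow> \<epsilon> * \<mu> ^ n \<le> gf_coeff (walks_from_to R \<theta> s) n x y"
proof -
  obtain k where k: "\<And>s. reach R k s \<theta>" using aperiodicE[OF aper] by metis
  define a where "a n s = gf_coeff (walks_from_to R \<theta> s) n x y" for n s
  define \<epsilon> where "\<epsilon> = Min (range (\<lambda>s. a (Suc k) s / (\<mu> ^ Suc k * \<omega> s)))"
  have \<epsilon>: "0 < \<epsilon>"
    unfolding \<epsilon>_def using walks_pos[OF k] mu_pos omega_pos by (subst Min_gr_iff) (auto simp: a_def)
  have main: "\<epsilon> * \<mu> ^ n * \<omega> s \<le> a n s" if "Suc k \<le> n" for n s
    using that
  proof (induction n arbitrary: s rule: dec_induct)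
    case base
    have "\<epsilon> \<le> a (Suc k) s / (\<mu> ^ Suc k * \<omega> s)" unfolding \<epsilon>_def by (rule Min_le) auto
    then show ?case using mu_pos omega_pos[of s] by (simp add: pos_le_divide_eq mult.assoc)
  next
    case (step n)
    have "\<epsilon> * \<mu> ^ Suc n * \<omega> s = \<epsilon> * \<mu> ^ n * (\<mu> * \<omega> s)" by simp
    also have "\<dots> = step_weight x y s * (\<Sum>l | R s l. \<epsilon> * \<mu> ^ n * \<omega> l)"
      unfolding eigen[symmetric] sum_distrib_left[symmetric] by simp
    also have "\<dots> \<le> step_weight x y s * (\<Sum>l | R s l. a n l)"
      using less_imp_le[OF wt_pos] step.IH by (intro mult_left_mono sum_mono) auto
    also have "\<dots> = a (Suc n) s"
      using step x_pos y_pos by (simp add: a_def walks_from_to_coeff_Suc)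
    finally show ?case .
  qed
  define m where "m = Min (range \<omega>)"
  have m: "0 < m" "\<And>s. m \<le> \<omega> s"
    unfolding m_def using omega_pos by (auto simp: Min_gr_iff)
  have "\<epsilon> * m * \<mu> ^ n \<le> a n s" if "Suc k \<le> n" for n s
  proof -
    have "\<epsilon> * \<mu> ^ n * m \<le> \<epsilon> * \<mu> ^ n * \<omega> s"
      using \<epsilon> mu_pos m by (intro mult_left_mono) auto
    then show ?thesis using main[OF that, of s] by (simp add: mult_ac)
  qed
  then show ?thesis using that[of "\<epsilon> * m" "Suc k"] \<epsilon> m unfolding a_def by simp
qed

end

lemma step_weight_change:
  assumes "y \<noteq> 0"
  shows "step_weight x y s * (z / y) powi rise s = step_weight x z s"
  using assms by (cases s) (auto simp: step_weight_def rise_def field_simps power_int_minus)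

text \<open>
  The left-hand side is the weight of the walks that go below the floor. The right-hand side is a
  supersolution of their first-step recursion: by \<open>step_weight_change\<close> a step acts on
  \<open>(y' / y) powi b * \<omega>' s\<close> like the transfer matrix at \<open>y'\<close>, with eigenvalue \<open>\<mu>' \<le> \<mu>\<close>. Probabilistically, the
  bound is the maximal inequality for a supermartingale.
\<close>

lemma doomed_walks_le:
  assumes "perron R x y \<mu> \<omega>" "perron R x y' \<mu>' \<omega>'" "\<mu>' \<le> \<mu>"
  obtains K where "0 < K"
    "\<And>n b s. 0 \<le> b \<Longrightarrow> gf_coeff (walks_from_to R \<theta> s) n x y - gf_coeff (floored_walks R \<theta> b s) n x y
      \<le> K * (y' / y) powi b * \<omega>' s * \<mu> ^ n"
proof -
  interpret hi: perron R x y \<mu> \<omega> by fact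
  interpret lo: perron R x y' \<mu>' \<omega>' by fact
  define q where "q = y' / y"
  have q: "0 < q" using hi.y_pos lo.y_pos by (simp add: q_def)
  \<comment> \<open>A walk leaves from height 0 by a south step. \<open>K\<close> is chosen so that the bound then covers all
    its continuations.\<close>
  define K where "K = step_weight x y \<theta> / (\<mu> * \<omega> \<theta>) * \<omega> South / \<omega>' South"
  have K: "0 < K"
    unfolding K_def using hi.wt_pos hi.omega_pos hi.mu_pos lo.omega_pos by simp
  define a where "a n s = gf_coeff (walks_from_to R \<theta> s) n x y" for n s
  define g where "g n b s = gf_coeff (floored_walks R \<theta> b s) n x y" for n b s
  have "a n s - g n b s \<le> K * q powi b * \<omega>' s * \<mu> ^ n" if "0 \<le> b" for n b s
    using that
  proof (induction n arbitrary: b s)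
    case 0
    then show ?case using K q lo.omega_pos[of s] by (simp add: a_def g_def)
  next
    case (Suc n)
    show ?case
    proof (cases "0 \<le> b + rise s")
      case True
      have "a (Suc n) s - g (Suc n) b s =
          step_weight x y s * (\<Sum>l | R s l. a n l - g n (b + rise s) l)"
        using True hi.x_pos hi.y_pos
        by (simp add: a_def g_def walks_from_to_coeff_Suc floored_coeff_Suc sum_subtractf algebra_simps)
      also have "\<dots> \<le> step_weight x y s * (\<Sum>l | R s l. K * q powi (b + rise s) * \<omega>' l * \<mu> ^ n)"
        using less_imp_le[OF hi.wt_pos] by (intro mult_left_mono sum_mono Suc.IH True) auto
      also have "\<dots> = step_weight x y s * (K * q powi (b + rise s) * \<mu> ^ n * (\<Sum>l | R s l. \<omega>' l))"
        unfolding sum_distrib_left by (simp add: mult_ac)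
      also have "\<dots> = K * q powi b * \<mu> ^ n * (step_weight x y s * q powi rise s * (\<Sum>l | R s l. \<omega>' l))"
        using q by (simp add: power_int_add mult_ac)
      also have "step_weight x y s * q powi rise s * (\<Sum>l | R s l. \<omega>' l) = \<mu>' * \<omega>' s"
        using hi.y_pos lo.eigen[of s] unfolding q_def by (subst step_weight_change) auto
      also have "K * q powi b * \<mu> ^ n * (\<mu>' * \<omega>' s) \<le> K * q powi b * \<mu> ^ n * (\<mu> * \<omega>' s)"
        using K q hi.mu_pos assms(3) lo.omega_pos[of s] by (intro mult_left_mono mult_right_mono) auto
      finally show ?thesis by (simp add: mult_ac)
    next
      case False
      then have b: "b = 0" "s = South"
        using Suc.prems by (cases s; simp add: rise_def)+
      have "a (Suc n) s - g (Suc n) b s = a (Suc n) South"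
        using False b hi.x_pos hi.y_pos by (simp add: g_def floored_coeff_Suc)
      also have "\<dots> \<le> step_weight x y \<theta> / (\<mu> * \<omega> \<theta>) * \<mu> ^ Suc n * \<omega> South"
        unfolding a_def by (rule hi.walks_upper)
      also have "\<dots> = K * q powi b * \<omega>' s * \<mu> ^ Suc n"
        using lo.omega_pos[of South] b by (simp add: K_def)
      finally show ?thesis .
    qed
  qed
  then show ?thesis using that K unfolding a_def g_def q_def by blast
qed

text \<open>
  For a floor deep enough, the walks that go below it weigh at most half of a lower bound for all walks.
\<close>

lemma floored_lower:
  assumes "perron R x y \<mu> \<omega>" "perron R x y' \<mu>' \<omega>'" "\<mu>' \<le> \<mu>" "y' < y"
  obtains b \<epsilon> N where "0 < \<epsilon>"
    "\<And>n s. N \<le> n \<Longrightarrow> \<epsilon> * \<mu> ^ n \<le> gf_coeff (floored_walks R \<theta> (int b) s) n x y"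
proof -
  interpret hi: perron R x y \<mu> \<omega> by fact
  interpret lo: perron R x y' \<mu>' \<omega>' by fact
  obtain K where K: "0 < K"
    "\<And>n b s. 0 \<le> b \<Longrightarrow> gf_coeff (walks_from_to R \<theta> s) n x y - gf_coeff (floored_walks R \<theta> b s) n x y
      \<le> K * (y' / y) powi b * \<omega>' s * \<mu> ^ n"
    using doomed_walks_le[OF assms(1-3), of \<theta>] by metis
  obtain \<epsilon> N where \<epsilon>: "0 < \<epsilon>"
    "\<And>n s. N \<le> n \<Longrightarrow> \<epsilon> * \<mu> ^ n \<le> gf_coeff (walks_from_to R \<theta> s) n x y"
    using hi.walks_lower[of \<theta>] by blast
  define M where "M = Max (range \<omega>')"
  have M: "\<omega>' s \<le> M" for s unfolding M_def by simp
  have M_pos: "0 < M" using M[of South] lo.omega_pos[of South] by linarith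
  have "(\<lambda>b. (y' / y) ^ b) \<longlonglongrightarrow> 0"
    using assms(4) hi.y_pos lo.y_pos by (intro LIMSEQ_power_zero) auto
  moreover have "0 < \<epsilon> / (2 * K * M)" using \<epsilon> K M_pos by simp
  ultimately have "\<forall>\<^sub>F b in sequentially. (y' / y) ^ b < \<epsilon> / (2 * K * M)"
    by (rule order_tendstoD(2))
  then obtain b where b: "(y' / y) ^ b < \<epsilon> / (2 * K * M)"
    by (auto simp: eventually_sequentially)
  have "\<epsilon> / 2 * \<mu> ^ n \<le> gf_coeff (floored_walks R \<theta> (int b) s) n x y" if "N \<le> n" for n s
  proof -
    have "K * (y' / y) ^ b * \<omega>' s \<le> K * (y' / y) ^ b * M"
      using K hi.y_pos lo.y_pos M by (intro mult_left_mono) auto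
    also have "\<dots> \<le> \<epsilon> / 2"
      using b K M_pos by (simp add: field_simps)
    finally have "K * (y' / y) ^ b * \<omega>' s * \<mu> ^ n \<le> \<epsilon> / 2 * \<mu> ^ n"
      using hi.mu_pos by (intro mult_right_mono) auto
    then show ?thesis
      using K(2)[of "int b" s n] \<epsilon>(2)[OF that, of s] by simp
  qed
  then show ?thesis using that[of "\<epsilon> / 2" N b] \<epsilon>(1) by simp
qed

text \<open>
  The loop runs from position \<open>i\<close> to the next occurrence of \<open>\<alpha>\<close>, so it is a first return.
\<close>

lemma loop_avoidingE:
  assumes "walk R w" "i < j" "j < length w" "w ! i = \<alpha>" "w ! j = \<alpha>" "\<alpha> \<noteq> \<beta>"
    and avoid: "\<And>k. i < k \<Longrightarrow> k < j \<Longrightarrow> w ! k \<noteq> \<beta>"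
  obtains u where "u \<in> B_walks R \<alpha>" "\<beta> \<notin> set u"
proof -
  define m where "m = (LEAST m. i < m \<and> w ! m = \<alpha>)"
  have m: "i < m" "w ! m = \<alpha>" "m \<le> j"
    unfolding m_def using LeastI[of "\<lambda>m. i < m \<and> w ! m = \<alpha>" j] Least_le[of "\<lambda>m. i < m \<and> w ! m = \<alpha>" j] assms
    by auto
  have first: "w ! k \<noteq> \<alpha>" if "i < k" "k < m" for k
    using not_less_Least[of k "\<lambda>m. i < m \<and> w ! m = \<alpha>"] that unfolding m_def by auto
  define u where "u = map ((!) w) [Suc i..<Suc m]"
  have u: "u = map ((!) w) [Suc i..<m] @ [\<alpha>]"
    using m by (simp add: u_def)
  have len: "length u = m - i" using m by (simp add: u_def)
  have nth: "u ! k = w ! (Suc i + k)" if "k < m - i" for k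
    using that unfolding u_def by (subst nth_map) (auto simp del: upt_Suc)
  have "walk R u"
    unfolding walk_def
  proof (intro conjI allI impI)
    fix k assume "Suc k < length u"
    then show "R (u ! k) (u ! Suc k)"
      using assms(1,3) m unfolding walk_def len by (simp add: nth)
  qed (simp add: u)
  moreover have "R \<alpha> (hd u)"
  proof -
    have "hd u = w ! Suc i" using nth[of 0] m by (simp add: hd_conv_nth u)
    then show ?thesis using assms(1-4) m unfolding walk_def by auto
  qed
  moreover have "count_list u \<alpha> = 1"
  proof -
    have "w ! k \<noteq> \<alpha>" if "k \<in> {Suc i..<m}" for k
      using first[of k] that by simp
    then have "\<alpha> \<notin> set (map ((!) w) [Suc i..<m])" by fastforce
    then show ?thesis by (simp add: u count_list_0_iff)
  qed
  moreover have "last u = \<alpha>" by (simp add: u)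
  moreover have "\<beta> \<notin> set u"
  proof -
    have "w ! k \<noteq> \<beta>" if "k \<in> {Suc i..<m}" for k
      using avoid[of k] that m by simp
    then have "\<beta> \<notin> set (map ((!) w) [Suc i..<m])" by fastforce
    then show ?thesis using assms(6) by (simp add: u)
  qed
  ultimately show ?thesis using that by (auto simp: B_walks_def)
qed

lemma rise_simps [simp]: "rise East = 0" "rise North = 1" "rise West = 0" "rise South = -1"
  by (auto simp: rise_def)

lemma height_count: "height w = int (count_list w North) - int (count_list w South)"
proof (induction w)
  case (Cons s w)
  then show ?case by (cases s) auto
qed simp

lemma north_loopE:
  assumes "vertically_unbounded R"
  obtains u where "u \<in> B_walks R North" "South \<notin> set u" "height u = 1"
proof -
  obtain w i j where w: "walk R w" "i < j" "j < length w" "w ! i = North" "w ! j = North"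
      "\<And>k. i < k \<Longrightarrow> k < j \<Longrightarrow> w ! k \<noteq> South"
    using assms unfolding vertically_unbounded_def south_bound_def by blast
  obtain u where u: "u \<in> B_walks R North" "South \<notin> set u"
    by (rule loop_avoidingE[OF w(1-5) _ w(6)]) auto
  then have "height u = 1"
    by (simp add: height_count B_walks_def count_list_0_iff)
  then show ?thesis using that u by blast
qed

lemma south_loopE:
  assumes "vertically_unbounded R"
  obtains u where "u \<in> B_walks R South" "height u = -1"
proof -
  obtain w i j where w: "walk R w" "i < j" "j < length w" "w ! i = South" "w ! j = South"
      "\<And>k. i < k \<Longrightarrow> k < j \<Longrightarrow> w ! k \<noteq> North"
    using assms unfolding vertically_unbounded_def north_bound_def by blast
  obtain u where u: "u \<in> B_walks R South" "North \<notin> set u"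
    by (rule loop_avoidingE[OF w(1-5) _ w(6)]) auto
  then have "height u = -1"
    by (simp add: height_count B_walks_def count_list_0_iff)
  then show ?thesis using that u by blast
qed

lemma floored_prepend_step:
  assumes "0 < x" "0 < y" "s \<noteq> South" "R s l" "0 \<le> b"
  shows "step_weight x y s * gf_coeff (floored_walks R \<theta> (b + rise s) l) n x y
    \<le> gf_coeff (floored_walks R \<theta> b s) (Suc n) x y"
proof -
  have "gf_coeff (floored_walks R \<theta> (b + rise s) l) n x y \<le>
      (\<Sum>l | R s l. gf_coeff (floored_walks R \<theta> (b + rise s) l) n x y)"
    using assms by (intro member_le_sum) (auto simp: gf_coeff_nonneg)
  moreover have "0 \<le> b + rise s" using assms by (cases s) auto
  ultimately show ?thesis
    using assms step_weight_pos[of x y s] by (simp add: floored_coeff_Suc)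
qed

lemma floored_prepend:
  assumes "0 < x" "0 < y" "0 \<le> b" "walk R u" "South \<notin> set u" "R (last u) l"
  shows "walk_weight x y u * gf_coeff (floored_walks R \<theta> (b + height u) l) n x y
    \<le> gf_coeff (floored_walks R \<theta> b (hd u)) (length u + n) x y"
  using assms(3-)
proof (induction u arbitrary: b)
  case (Cons s u)
  note w = walk_weight_Cons[of x y s u]
  show ?case
  proof (cases "u = []")
    case True
    then show ?thesis
      using floored_prepend_step[of x y s R l b \<theta> n] Cons.prems assms by (simp add: walk_weight_Cons)
  next
    case False
    have b: "0 \<le> b + rise s" using Cons.prems by (cases s) auto
    have "walk_weight x y u * gf_coeff (floored_walks R \<theta> (b + rise s + height u) l) n x y
        \<le> gf_coeff (floored_walks R \<theta> (b + rise s) (hd u)) (length u + n) x y"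
      using Cons.prems False b by (intro Cons.IH) auto
    then have "step_weight x y s * (walk_weight x y u * gf_coeff (floored_walks R \<theta> (b + rise s + height u) l) n x y)
        \<le> step_weight x y s * gf_coeff (floored_walks R \<theta> (b + rise s) (hd u)) (length u + n) x y"
      using step_weight_pos[of x y s] assms by simp
    also have "\<dots> \<le> gf_coeff (floored_walks R \<theta> b s) (Suc (length u + n)) x y"
      using Cons.prems False assms by (intro floored_prepend_step) auto
    finally show ?thesis
      using assms by (simp add: w mult.assoc add.assoc)
  qed
qed simp

text \<open>
  Repeating an ascending loop \<open>h\<close> times in front of a walk lowers the floor by \<open>h\<close> relative to the walk.
\<close>

lemma floored_raise:
  assumes "0 < x" "0 < y" "u \<in> B_walks R North" "South \<notin> set u" "height u = 1"
  shows "0 \<le> b \<Longrightarrow> walk_weight x y u ^ h * gf_coeff (floored_walks R \<theta> (b + int h) (hd u)) n x y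
    \<le> gf_coeff (floored_walks R \<theta> b (hd u)) (h * length u + n) x y"
proof (induction h arbitrary: b)
  case (Suc h)
  have "walk_weight x y u ^ h * gf_coeff (floored_walks R \<theta> ((b + 1) + int h) (hd u)) n x y
    \<le> gf_coeff (floored_walks R \<theta> (b + 1) (hd u)) (h * length u + n) x y"
    using Suc.prems by (intro Suc.IH) auto
  then have "walk_weight x y u * (walk_weight x y u ^ h * gf_coeff (floored_walks R \<theta> (b + 1 + int h) (hd u)) n x y)
    \<le> walk_weight x y u * gf_coeff (floored_walks R \<theta> (b + height u) (hd u)) (h * length u + n) x y"
    using walk_weight_pos[of x y u] assms by simp
  also have "\<dots> \<le> gf_coeff (floored_walks R \<theta> b (hd u)) (length u + (h * length u + n)) x y"
    using assms Suc.prems by (intro floored_prepend) (auto simp: B_walks_def)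
  finally show ?case by (simp add: add_ac mult_ac)
qed simp

text \<open>
  Climb with the north loop until the floor is deep enough for \<open>floored_lower\<close>, at the cost of a constant factor.
\<close>

lemma H_lower:
  assumes "perron R x y \<mu> \<omega>" "perron R x y' \<mu>' \<omega>'" "\<mu>' \<le> \<mu>" "y' < y" "vertically_unbounded R"
  obtains c N where "0 < c" "\<And>n. N \<le> n \<Longrightarrow> c * \<mu> ^ n \<le> gf_coeff (H_walks R \<theta>) n x y"
proof -
  interpret perron R x y \<mu> \<omega> by fact
  obtain b \<epsilon> N where b: "0 < \<epsilon>"
    "\<And>n s. N \<le> n \<Longrightarrow> \<epsilon> * \<mu> ^ n \<le> gf_coeff (floored_walks R \<theta> (int b) s) n x y"
    using floored_lower[OF assms(1-4), of \<theta>] by metis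
  obtain u where u: "u \<in> B_walks R North" "South \<notin> set u" "height u = 1"
    using north_loopE[OF assms(5)] by metis
  define L where "L = b * length u"
  define W where "W = walk_weight x y u ^ b"
  have W: "0 < W" unfolding W_def using x_pos y_pos by (simp add: walk_weight_pos)
  have "W * \<epsilon> / \<mu> ^ L * \<mu> ^ n \<le> gf_coeff (H_walks R \<theta>) n x y" if "L + N \<le> n" for n
  proof -
    define m where "m = n - L"
    have n: "n = L + m" and m: "N \<le> m" using that by (auto simp: m_def)
    have "W * \<epsilon> / \<mu> ^ L * \<mu> ^ n = W * (\<epsilon> * \<mu> ^ m)"
      using mu_pos by (simp add: n power_add)
    also have "\<dots> \<le> W * gf_coeff (floored_walks R \<theta> (int b) (hd u)) m x y"
      using W b(2)[OF m] by simp
    also have "\<dots> \<le> gf_coeff (floored_walks R \<theta> 0 (hd u)) (L + m) x y"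
      using floored_raise[OF x_pos y_pos u, of 0 b \<theta> m] by (simp add: W_def L_def)
    also have "\<dots> \<le> gf_coeff (H_walks R \<theta>) (L + m) x y"
      unfolding H_coeff_floored using x_pos y_pos by (intro member_le_sum) (auto simp: gf_coeff_nonneg)
    finally show ?thesis by (simp add: n)
  qed
  moreover have "0 < W * \<epsilon> / \<mu> ^ L" using W b mu_pos by simp
  ultimately show ?thesis using that by blast
qed

section \<open>Convexity and differentiability of the smallest root\<close>

lemma abs_height_le: "\<bar>height w\<bar> \<le> int (length w)"
proof (induction w)
  case (Cons s w)
  then show ?case by (cases s) auto
qed simp

lemma exp_gt_one_plus:
  fixes z :: real
  assumes "z \<noteq> 0"
  shows "1 + z < exp z"
proof -
  have "1 + z \<noteq> exp z"
    using ln_eq_minus_one[of "exp z"] assms by auto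
  then show ?thesis using exp_ge_add_one_self[of z] by linarith
qed

definition height_coeff :: "step list set \<Rightarrow> nat \<Rightarrow> real \<Rightarrow> real \<Rightarrow> real" where
  "height_coeff W n x y = (\<Sum>w | w \<in> W \<and> length w = n. real_of_int (height w) * walk_weight x y w)"

text \<open>
  Along a line in the coordinates \<open>ln t\<close> and \<open>ln y\<close>, each walk contributes an exponential of a linear
  function. The generating function is therefore convex in these coordinates.
\<close>

lemma gf_term_exp:
  assumes "0 < y"
  shows "gf_coeff W n x (y * exp (\<beta> * h)) * (r * exp (\<alpha> * h)) ^ n =
    (\<Sum>w | w \<in> W \<and> length w = n. walk_weight x y w * r ^ n * exp (h * (\<alpha> * n + \<beta> * height w)))"
proof -
  have "walk_weight x (y * exp (\<beta> * h)) w * (r * exp (\<alpha> * h)) ^ n =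
      walk_weight x y w * r ^ n * exp (h * (\<alpha> * n + \<beta> * height w))" for w
  proof -
    have "exp (h * (\<alpha> * n + \<beta> * height w)) = exp (\<alpha> * h) ^ n * exp (\<beta> * h) powi height w"
      by (simp add: exp_power_int exp_of_nat_mult[symmetric] exp_add[symmetric] algebra_simps)
    then show ?thesis
      by (simp add: walk_weight_def height_def power_mult_distrib power_int_mult_distrib)
  qed
  then show ?thesis by (simp add: gf_coeff_eq sum_distrib_right)
qed

context perron begin

text \<open>
  The moments are the partial derivatives of \<open>B\<close> with respect to \<open>ln t\<close> and \<open>ln y\<close> at the point
  \<open>(1 / \<mu>, y)\<close> of the curve \<open>B = 1\<close>.
\<close>

definition len_moment :: "step \<Rightarrow> real" where
  "len_moment \<theta> = (\<Sum>n. real n * (gf_coeff (B_walks R \<theta>) n x y * (1 / \<mu>) ^ n))"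

definition height_moment :: "step \<Rightarrow> real" where
  "height_moment \<theta> = (\<Sum>n. height_coeff (B_walks R \<theta>) n x y * (1 / \<mu>) ^ n)"

lemma abs_height_coeff_le:
  "\<bar>height_coeff W n x y\<bar> \<le> real n * gf_coeff W n x y"
proof -
  have "\<bar>real_of_int (height w) * walk_weight x y w\<bar> \<le> real n * walk_weight x y w"
    if "length w = n" for w
    using abs_height_le[of w] that walk_weight_pos[OF x_pos y_pos, of w]
    by (auto simp: abs_mult intro!: mult_right_mono)
  then have "\<bar>height_coeff W n x y\<bar> \<le> (\<Sum>w | w \<in> W \<and> length w = n. real n * walk_weight x y w)"
    unfolding height_coeff_def by (intro order_trans[OF sum_abs] sum_mono) auto
  then show ?thesis by (simp add: gf_coeff_eq sum_distrib_left)
qed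

text \<open>
  The geometric decay of the coefficients leaves room for a factor \<open>exp \<delta> ^ n\<close>. This factor dominates the
  series at all points near \<open>(1 / \<mu>, y)\<close>, as heights are bounded by lengths.
\<close>

lemma summable_len_exp:
  obtains \<delta> where "0 < \<delta>"
    "summable (\<lambda>n. real n * (gf_coeff (B_walks R \<theta>) n x y * (1 / \<mu>) ^ n) * exp \<delta> ^ n)"
proof -
  obtain \<kappa> K where \<kappa>: "0 < \<kappa>" "\<kappa> < 1" "0 < K"
    "\<And>n. gf_coeff (B_walks R \<theta>) n x y \<le> K * (\<kappa> * \<mu>) ^ n"
    using B_decay[of \<theta>] by blast
  define \<delta> where "\<delta> = - ln \<kappa> / 2"
  have \<delta>: "0 < \<delta>" using \<kappa> by (simp add: \<delta>_def)
  define c where "c = \<kappa> * exp \<delta>"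
  have "exp \<delta> < exp (- ln \<kappa>)" using \<kappa> by (simp add: \<delta>_def)
  then have c: "0 < c" "c < 1" using \<kappa> by (auto simp: c_def exp_minus field_simps)
  have "summable (\<lambda>n. K * (of_nat (Suc n) * c ^ n))"
    using c by (intro summable_mult sums_summable[OF geometric_deriv_sums]) auto
  then have "summable (\<lambda>n. real n * (gf_coeff (B_walks R \<theta>) n x y * (1 / \<mu>) ^ n) * exp \<delta> ^ n)"
  proof (rule summable_comparison_test'[of _ 0])
    fix n :: nat
    have "gf_coeff (B_walks R \<theta>) n x y * (1 / \<mu>) ^ n \<le> K * (\<kappa> * \<mu>) ^ n * (1 / \<mu>) ^ n"
      using \<kappa>(4) mu_pos by (intro mult_right_mono) auto
    also have "\<dots> = K * \<kappa> ^ n"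
      using mu_pos by (simp add: power_mult_distrib power_one_over)
    finally have "real n * (gf_coeff (B_walks R \<theta>) n x y * (1 / \<mu>) ^ n) \<le> real (Suc n) * (K * \<kappa> ^ n)"
      by (rule mult_mono[rotated]) (use B_coeff_nonneg[of \<theta> n] mu_pos in auto)
    then have "real n * (gf_coeff (B_walks R \<theta>) n x y * (1 / \<mu>) ^ n) * exp \<delta> ^ n
        \<le> real (Suc n) * (K * \<kappa> ^ n) * exp \<delta> ^ n"
      by (rule mult_right_mono) simp
    then show "norm (real n * (gf_coeff (B_walks R \<theta>) n x y * (1 / \<mu>) ^ n) * exp \<delta> ^ n)
        \<le> K * (of_nat (Suc n) * c ^ n)"
      using B_coeff_nonneg mu_pos by (simp add: c_def power_mult_distrib mult_ac)
  qed
  then show ?thesis using that \<delta> by blast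
qed

lemma summable_len:
  "summable (\<lambda>n. real n * (gf_coeff (B_walks R \<theta>) n x y * (1 / \<mu>) ^ n))"
proof -
  obtain \<delta> where \<delta>: "0 < \<delta>"
    "summable (\<lambda>n. real n * (gf_coeff (B_walks R \<theta>) n x y * (1 / \<mu>) ^ n) * exp \<delta> ^ n)"
    using summable_len_exp by blast
  show ?thesis
  proof (rule summable_comparison_test'[OF \<delta>(2), of 0])
    fix n
    have "1 \<le> exp \<delta> ^ n" using \<delta> by (intro one_le_power) simp
    then have "real n * (gf_coeff (B_walks R \<theta>) n x y * (1 / \<mu>) ^ n) * 1
      \<le> real n * (gf_coeff (B_walks R \<theta>) n x y * (1 / \<mu>) ^ n) * exp \<delta> ^ n"
      using B_coeff_nonneg mu_pos by (intro mult_left_mono) auto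
    then show "norm (real n * (gf_coeff (B_walks R \<theta>) n x y * (1 / \<mu>) ^ n))
      \<le> real n * (gf_coeff (B_walks R \<theta>) n x y * (1 / \<mu>) ^ n) * exp \<delta> ^ n"
      using B_coeff_nonneg mu_pos by simp
  qed
qed

lemma len_sums:
  "(\<lambda>n. real n * (gf_coeff (B_walks R \<theta>) n x y * (1 / \<mu>) ^ n)) sums len_moment \<theta>"
  unfolding len_moment_def by (rule summable_sums[OF summable_len])

lemma height_sums:
  "(\<lambda>n. height_coeff (B_walks R \<theta>) n x y * (1 / \<mu>) ^ n) sums height_moment \<theta>"
  unfolding height_moment_def
proof (rule summable_sums, rule summable_comparison_test'[OF summable_len[of \<theta>], of 0])
  fix n
  have "\<bar>height_coeff (B_walks R \<theta>) n x y\<bar> * (1 / \<mu>) ^ n \<le> real n * gf_coeff (B_walks R \<theta>) n x y * (1 / \<mu>) ^ n"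
    using abs_height_coeff_le mu_pos by (intro mult_right_mono) auto
  then show "norm (height_coeff (B_walks R \<theta>) n x y * (1 / \<mu>) ^ n)
      \<le> real n * (gf_coeff (B_walks R \<theta>) n x y * (1 / \<mu>) ^ n)"
    using mu_pos by (simp add: abs_mult mult_ac)
qed

lemma len_moment_pos: "0 < len_moment \<theta>"
proof -
  have "(1::real) \<le> len_moment \<theta>"
  proof (rule sums_le[OF _ B_sums_1 len_sums])
    fix n
    show "gf_coeff (B_walks R \<theta>) n x y * (1 / \<mu>) ^ n \<le> real n * (gf_coeff (B_walks R \<theta>) n x y * (1 / \<mu>) ^ n)"
    proof (cases "n = 0")
      case False
      then have "1 * (gf_coeff (B_walks R \<theta>) n x y * (1 / \<mu>) ^ n) \<le> real n * (gf_coeff (B_walks R \<theta>) n x y * (1 / \<mu>) ^ n)"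
        using B_coeff_nonneg mu_pos by (intro mult_right_mono) auto
      then show ?thesis by simp
    qed simp
  qed
  then show ?thesis by simp
qed

text \<open>
  Directional derivatives along lines in logarithmic coordinates suffice for all later uses: the coordinate
  directions give \<open>B_t\<close> and \<open>B_y\<close>, the others bracket the curve \<open>B = 1\<close>.
\<close>

lemma B_directional_derivative:
  fixes \<alpha> \<beta> :: real and \<theta> :: step
  defines "F \<equiv> \<lambda>n h. gf_coeff (B_walks R \<theta>) n x (y * exp (\<beta> * h)) * (1 / \<mu> * exp (\<alpha> * h)) ^ n"
  shows "\<exists>\<delta>>0. \<forall>h. \<bar>h\<bar> < \<delta> \<longrightarrow> summable (\<lambda>n. F n h)"
    and "((\<lambda>h. \<Sum>n. F n h) has_real_derivative \<alpha> * len_moment \<theta> + \<beta> * height_moment \<theta>) (at 0)"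
proof -
  \<comment> \<open>\<open>A * n\<close> bounds the exponents \<open>e n w\<close>; the summand 1 only makes \<open>A\<close> positive.\<close>
  define A where "A = \<bar>\<alpha>\<bar> + \<bar>\<beta>\<bar> + 1"
  have A: "0 < A" by (simp add: A_def)
  obtain \<delta>0 where \<delta>0: "0 < \<delta>0"
    "summable (\<lambda>n. real n * (gf_coeff (B_walks R \<theta>) n x y * (1 / \<mu>) ^ n) * exp \<delta>0 ^ n)"
    using summable_len_exp by blast
  define \<delta> where "\<delta> = \<delta>0 / A"
  have \<delta>: "0 < \<delta>" "\<delta> * A = \<delta>0" using \<delta>0 A by (auto simp: \<delta>_def)
  define W where "W n = {w. w \<in> B_walks R \<theta> \<and> length w = n}" for n
  define e where "e n w = \<alpha> * real n + \<beta> * real_of_int (height w)" for n and w :: "step list"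
  define F' where "F' n h = (\<Sum>w\<in>W n. walk_weight x y w * (1 / \<mu>) ^ n * (e n w * exp (h * e n w)))" for n h
  have F: "F n h = (\<Sum>w\<in>W n. walk_weight x y w * (1 / \<mu>) ^ n * exp (h * e n w))" for n h
    unfolding F_def W_def e_def by (rule gf_term_exp[OF y_pos])
  have deriv: "(F n has_real_derivative F' n h) (at h within S)" for n h S
    unfolding F F'_def by (auto intro!: derivative_eq_intros sum.cong)
  have e: "\<bar>e n w\<bar> \<le> A * real n" if "w \<in> W n" for n w
  proof -
    have "\<bar>real_of_int (height w)\<bar> \<le> real n"
      using abs_height_le[of w] that by (simp add: W_def)
    then have "\<bar>\<beta>\<bar> * \<bar>real_of_int (height w)\<bar> \<le> \<bar>\<beta>\<bar> * real n"
      by (intro mult_left_mono) auto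
    then have "\<bar>e n w\<bar> \<le> \<bar>\<alpha>\<bar> * real n + \<bar>\<beta>\<bar> * real n"
      unfolding e_def by (intro order_trans[OF abs_triangle_ineq]) (simp add: abs_mult)
    then show ?thesis by (simp add: A_def algebra_simps)
  qed
  have bound: "norm (F' n h) \<le> A * (real n * (gf_coeff (B_walks R \<theta>) n x y * (1 / \<mu>) ^ n) * exp \<delta>0 ^ n)"
    if "h \<in> {-\<delta>..\<delta>}" for n h
  proof -
    have "norm (walk_weight x y w * (1 / \<mu>) ^ n * (e n w * exp (h * e n w))) \<le>
      walk_weight x y w * (1 / \<mu>) ^ n * (A * real n * exp \<delta>0 ^ n)" if w: "w \<in> W n" for w
    proof -
      have "h * e n w \<le> \<bar>h\<bar> * \<bar>e n w\<bar>" by (metis abs_ge_self abs_mult)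
      also have "\<dots> \<le> \<delta> * (A * real n)"
        using e[OF w] \<open>h \<in> _\<close> by (intro mult_mono) auto
      also have "\<dots> = real n * \<delta>0" using \<delta> by (simp add: mult_ac)
      finally have "exp (h * e n w) \<le> exp \<delta>0 ^ n"
        by (simp add: exp_of_nat_mult[symmetric])
      then have "\<bar>e n w\<bar> * exp (h * e n w) \<le> A * real n * exp \<delta>0 ^ n"
        using e[OF w] A by (intro mult_mono) auto
      then have "walk_weight x y w * (1 / \<mu>) ^ n * (\<bar>e n w\<bar> * exp (h * e n w)) \<le>
        walk_weight x y w * (1 / \<mu>) ^ n * (A * real n * exp \<delta>0 ^ n)"
        using less_imp_le[OF walk_weight_pos[OF x_pos y_pos]] mu_pos by (intro mult_left_mono) auto
      then show ?thesis
        using less_imp_le[OF walk_weight_pos[OF x_pos y_pos]] mu_pos by (simp add: abs_mult)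
    qed
    then have "norm (F' n h) \<le> (\<Sum>w\<in>W n. walk_weight x y w * (1 / \<mu>) ^ n * (A * real n * exp \<delta>0 ^ n))"
      unfolding F'_def by (rule sum_norm_le)
    also have "\<dots> = gf_coeff (B_walks R \<theta>) n x y * (1 / \<mu>) ^ n * (A * real n * exp \<delta>0 ^ n)"
      unfolding gf_coeff_eq W_def sum_distrib_right by (rule refl)
    finally show ?thesis by (simp add: mult_ac)
  qed
  have unif: "uniformly_convergent_on {-\<delta>..\<delta>} (\<lambda>n h. \<Sum>i<n. F' i h)"
    by (rule Weierstrass_m_test'[OF bound summable_mult[OF \<delta>0(2)]])
  have F0: "F n 0 = gf_coeff (B_walks R \<theta>) n x y * (1 / \<mu>) ^ n" for n
    by (simp add: F_def)
  have summable0: "summable (\<lambda>n. F n 0)"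
    unfolding F0 by (rule sums_summable[OF B_sums_1])
  note series = has_field_derivative_series'[of "{-\<delta>..\<delta>}" F F' 0, OF _ deriv unif _ summable0]
  show "\<exists>\<delta>>0. \<forall>h. \<bar>h\<bar> < \<delta> \<longrightarrow> summable (\<lambda>n. F n h)"
    using \<delta>(1) by (intro exI[of _ \<delta>]) (auto intro!: series(1) simp: abs_less_iff)
  have F'0: "F' n 0 = \<alpha> * (real n * (gf_coeff (B_walks R \<theta>) n x y * (1 / \<mu>) ^ n)) +
      \<beta> * (height_coeff (B_walks R \<theta>) n x y * (1 / \<mu>) ^ n)" for n
    unfolding F'_def e_def gf_coeff_eq height_coeff_def W_def
    by (simp add: sum_distrib_left sum_distrib_right sum.distrib[symmetric] algebra_simps)
  have "(\<lambda>n. F' n 0) sums (\<alpha> * len_moment \<theta> + \<beta> * height_moment \<theta>)"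
    unfolding F'0 by (intro sums_add sums_mult len_sums height_sums)
  then have "(\<Sum>n. F' n 0) = \<alpha> * len_moment \<theta> + \<beta> * height_moment \<theta>"
    by (rule sums_unique[symmetric])
  moreover have "((\<lambda>h. \<Sum>n. F n h) has_real_derivative (\<Sum>n. F' n 0)) (at 0)"
    using \<delta>(1) by (intro series(2)) auto
  ultimately show "((\<lambda>h. \<Sum>n. F n h) has_real_derivative \<alpha> * len_moment \<theta> + \<beta> * height_moment \<theta>) (at 0)"
    by simp
qed

lemma B_sum_ge_1:
  assumes "1 / \<mu> \<le> t" "summable (\<lambda>n. gf_coeff (B_walks R \<theta>) n x y * t ^ n)"
  shows "1 \<le> (\<Sum>n. gf_coeff (B_walks R \<theta>) n x y * t ^ n)"
proof (rule sums_le[OF _ B_sums_1 summable_sums[OF assms(2)]])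
  fix n
  show "gf_coeff (B_walks R \<theta>) n x y * (1 / \<mu>) ^ n \<le> gf_coeff (B_walks R \<theta>) n x y * t ^ n"
    using assms(1) mu_pos by (intro mult_left_mono power_mono B_coeff_nonneg) auto
qed

text \<open>
  Summing \<open>1 + z \<le> exp z\<close> over the walks of \<open>B\<close> shows that the graph of \<open>ln (rho R x y)\<close> over \<open>ln y\<close> stays
  below its tangent at \<open>y\<close>; here \<open>ln (\<mu> / \<mu>')\<close> is the difference of the two values. One walk with
  \<open>z \<noteq> 0\<close> makes the inequality strict.
\<close>

lemma rho_supporting_line:
  assumes "perron R x y' \<mu>' \<omega>'"
  shows "len_moment \<theta> * ln (\<mu> / \<mu>') + height_moment \<theta> * ln (y' / y) \<le> 0"
    and "u \<in> B_walks R \<theta> \<Longrightarrow> real (length u) * ln (\<mu> / \<mu>') + height u * ln (y' / y) \<noteq> 0 \<Longrightarrow>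
      len_moment \<theta> * ln (\<mu> / \<mu>') + height_moment \<theta> * ln (y' / y) < 0"
proof -
  interpret b: perron R x y' \<mu>' \<omega>' by fact
  define \<alpha> where "\<alpha> = ln (\<mu> / \<mu>')"
  define \<beta> where "\<beta> = ln (y' / y)"
  have t: "1 / \<mu> * exp (\<alpha> * 1) = 1 / \<mu>'" "y * exp (\<beta> * 1) = y'"
    using mu_pos b.mu_pos y_pos b.y_pos by (auto simp: \<alpha>_def \<beta>_def)
  define e where "e w = \<alpha> * real (length w) + \<beta> * real_of_int (height w)" for w
  define W where "W n = {w. w \<in> B_walks R \<theta> \<and> length w = n}" for n
  let ?lower = "\<lambda>n. gf_coeff (B_walks R \<theta>) n x y * (1 / \<mu>) ^ n +
     (\<alpha> * (real n * (gf_coeff (B_walks R \<theta>) n x y * (1 / \<mu>) ^ n)) +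
      \<beta> * (height_coeff (B_walks R \<theta>) n x y * (1 / \<mu>) ^ n))"
  let ?upper = "\<lambda>n. gf_coeff (B_walks R \<theta>) n x y' * (1 / \<mu>') ^ n"
  have lower: "?lower n = (\<Sum>w\<in>W n. walk_weight x y w * (1 / \<mu>) ^ n * (1 + e w))" for n
  proof -
    have "(\<Sum>w\<in>W n. walk_weight x y w * (1 / \<mu>) ^ n * (1 + e w)) =
      (\<Sum>w\<in>W n. walk_weight x y w * (1 / \<mu>) ^ n * (1 + (\<alpha> * n + \<beta> * height w)))"
      by (rule sum.cong) (auto simp: e_def W_def)
    then show ?thesis
      unfolding gf_coeff_eq height_coeff_def W_def
      by (simp add: sum_distrib_left sum_distrib_right sum.distrib[symmetric] algebra_simps)
  qed
  have upper: "?upper n = (\<Sum>w\<in>W n. walk_weight x y w * (1 / \<mu>) ^ n * exp (e w))" for n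
  proof -
    have "?upper n = (\<Sum>w\<in>W n. walk_weight x y w * (1 / \<mu>) ^ n * exp (1 * (\<alpha> * n + \<beta> * height w)))"
      unfolding t[symmetric] W_def by (rule gf_term_exp[OF y_pos])
    also have "\<dots> = (\<Sum>w\<in>W n. walk_weight x y w * (1 / \<mu>) ^ n * exp (e w))"
      by (rule sum.cong) (auto simp: e_def W_def)
    finally show ?thesis .
  qed
  have pos: "0 < walk_weight x y w * (1 / \<mu>) ^ n" for w n
    using walk_weight_pos[OF x_pos y_pos] mu_pos by simp
  have le: "?lower n \<le> ?upper n" for n
    unfolding lower upper using less_imp_le[OF pos] by (intro sum_mono mult_left_mono) auto
  have sums_lower: "?lower sums (1 + (\<alpha> * len_moment \<theta> + \<beta> * height_moment \<theta>))"
    by (intro sums_add sums_mult B_sums_1 len_sums height_sums)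
  have sums_upper: "?upper sums 1" by (rule b.B_sums_1)
  have "1 + (\<alpha> * len_moment \<theta> + \<beta> * height_moment \<theta>) \<le> 1"
    by (rule sums_le[OF le sums_lower sums_upper])
  then show "len_moment \<theta> * ln (\<mu> / \<mu>') + height_moment \<theta> * ln (y' / y) \<le> 0"
    by (simp add: \<alpha>_def \<beta>_def mult_ac)
  show "len_moment \<theta> * ln (\<mu> / \<mu>') + height_moment \<theta> * ln (y' / y) < 0"
    if u: "u \<in> B_walks R \<theta>" "real (length u) * ln (\<mu> / \<mu>') + height u * ln (y' / y) \<noteq> 0"
  proof -
    have "e u \<noteq> 0" using u(2) by (simp add: e_def \<alpha>_def \<beta>_def mult_ac)
    then have "1 + e u < exp (e u)" by (rule exp_gt_one_plus)
    then have "?lower (length u) < ?upper (length u)"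
      unfolding lower upper using u(1) pos less_imp_le[OF pos]
      by (intro sum_strict_mono_ex1 ballI mult_left_mono bexI[of _ u] mult_strict_left_mono)
         (auto simp: W_def)
    then have "1 + (\<alpha> * len_moment \<theta> + \<beta> * height_moment \<theta>) < 1"
      by (rule sums_strict_mono[OF sums_lower sums_upper le])
    then show ?thesis by (simp add: \<alpha>_def \<beta>_def mult_ac)
  qed
qed

end

lemma perron_exists:
  assumes "aperiodic R" "0 < x" "0 < y"
  obtains \<mu> \<omega> where "perron R x y \<mu> \<omega>"
  using perron_pair_exists[OF assms] assms by (metis perron.intro)

context perron begin

lemma rho_at: "0 < y' \<Longrightarrow> \<exists>\<mu>' \<omega>'. perron R x y' \<mu>' \<omega>' \<and> rho R x y' = 1 / \<mu>'"
  using perron_exists[OF aper x_pos] perron.rho_eq by metis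

text \<open>
  At points where \<open>B < 1\<close> the variable \<open>t\<close> is still below the smallest root.
\<close>

lemma rho_gt_along:
  fixes \<alpha> h :: real and \<theta> :: step
  defines "F \<equiv> \<lambda>n h. gf_coeff (B_walks R \<theta>) n x (y * exp h) * (1 / \<mu> * exp (\<alpha> * h)) ^ n"
  assumes "summable (\<lambda>n. F n h)" "(\<Sum>n. F n h) < 1"
  shows "\<alpha> * h < ln (rho R x (y * exp h) * \<mu>)"
proof -
  obtain \<mu>' \<omega>' where b: "perron R x (y * exp h) \<mu>' \<omega>'" "rho R x (y * exp h) = 1 / \<mu>'"
    using rho_at[of "y * exp h"] y_pos by auto
  interpret b: perron R x "y * exp h" \<mu>' \<omega>' by (rule b(1))
  have "\<not> 1 / \<mu>' \<le> 1 / \<mu> * exp (\<alpha> * h)"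
    using b.B_sum_ge_1[of "1 / \<mu> * exp (\<alpha> * h)" \<theta>] assms by (auto simp: F_def)
  then have "exp (\<alpha> * h) < 1 / \<mu>' * \<mu>" using mu_pos by (simp add: field_simps)
  then have "ln (exp (\<alpha> * h)) < ln (1 / \<mu>' * \<mu>)"
    using mu_pos b.mu_pos by (subst ln_less_cancel_iff) auto
  then show ?thesis by (simp add: b(2))
qed

text \<open>
  The tangent is an upper bound by \<open>rho_supporting_line\<close>. A line through the point with slightly smaller slope on
  the right, or slightly larger slope on the left, has \<open>B < 1\<close> near the point by its directional derivative,
  so the curve runs above it.
\<close>

lemma ln_rho_derivative:
  fixes \<theta> :: step
  defines "p \<equiv> - height_moment \<theta> / len_moment \<theta>"
  shows "((\<lambda>h. ln (rho R x (y * exp h) * \<mu>)) has_real_derivative p) (at 0)"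
proof -
  define \<sigma> where "\<sigma> h = ln (rho R x (y * exp h) * \<mu>)" for h
  have \<sigma>0: "\<sigma> 0 = 0" using mu_pos by (simp add: \<sigma>_def rho_eq)
  have upper: "\<sigma> h \<le> p * h" for h
  proof -
    obtain \<mu>' \<omega>' where b: "perron R x (y * exp h) \<mu>' \<omega>'" "rho R x (y * exp h) = 1 / \<mu>'"
      using rho_at[of "y * exp h"] y_pos by auto
    have "len_moment \<theta> * \<sigma> h + height_moment \<theta> * h \<le> 0"
      using rho_supporting_line(1)[OF b(1), of \<theta>] y_pos by (simp add: \<sigma>_def b(2))
    then show ?thesis
      using len_moment_pos[of \<theta>] by (simp add: p_def field_simps)
  qed
  have lower: "\<exists>d>0. \<forall>h. h \<noteq> 0 \<and> \<bar>h\<bar> < d \<longrightarrow> p * h - \<epsilon> * \<bar>h\<bar> < \<sigma> h" if \<epsilon>: "0 < \<epsilon>" for \<epsilon>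
  proof -
    define F where "F \<alpha> n h = gf_coeff (B_walks R \<theta>) n x (y * exp (1 * h)) * (1 / \<mu> * exp (\<alpha> * h)) ^ n"
      for \<alpha> n h
    have F0: "(\<Sum>n. F \<alpha> n 0) = 1" for \<alpha>
      using sums_unique[OF B_sums_1[of \<theta>]] by (simp add: F_def)
    have D: "((\<lambda>h. \<Sum>n. F \<alpha> n h) has_real_derivative \<alpha> * len_moment \<theta> + 1 * height_moment \<theta>) (at 0)" for \<alpha>
      unfolding F_def by (rule B_directional_derivative(2))
    have "(p - \<epsilon>) * len_moment \<theta> + 1 * height_moment \<theta> = - (\<epsilon> * len_moment \<theta>)"
      using len_moment_pos[of \<theta>] by (simp add: p_def field_simps)
    then have "(p - \<epsilon>) * len_moment \<theta> + 1 * height_moment \<theta> < 0"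
      using \<epsilon> len_moment_pos[of \<theta>] by simp
    from DERIV_neg_dec_right[OF D this] obtain d1 where
      d1: "0 < d1" "\<And>h. 0 < h \<Longrightarrow> h < d1 \<Longrightarrow> (\<Sum>n. F (p - \<epsilon>) n h) < 1"
      by (auto simp: F0)
    have "(p + \<epsilon>) * len_moment \<theta> + 1 * height_moment \<theta> = \<epsilon> * len_moment \<theta>"
      using len_moment_pos[of \<theta>] by (simp add: p_def field_simps)
    then have "0 < (p + \<epsilon>) * len_moment \<theta> + 1 * height_moment \<theta>"
      using \<epsilon> len_moment_pos[of \<theta>] by simp
    from DERIV_pos_inc_left[OF D this] obtain d2 where
      d2: "0 < d2" "\<And>h. 0 < h \<Longrightarrow> h < d2 \<Longrightarrow> (\<Sum>n. F (p + \<epsilon>) n (- h)) < 1"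
      by (auto simp: F0)
    obtain d3 where d3: "0 < d3" "\<And>h. \<bar>h\<bar> < d3 \<Longrightarrow> summable (\<lambda>n. F (p - \<epsilon>) n h)"
      using B_directional_derivative(1)[of \<theta> 1 "p - \<epsilon>"] unfolding F_def by auto
    obtain d4 where d4: "0 < d4" "\<And>h. \<bar>h\<bar> < d4 \<Longrightarrow> summable (\<lambda>n. F (p + \<epsilon>) n h)"
      using B_directional_derivative(1)[of \<theta> 1 "p + \<epsilon>"] unfolding F_def by auto
    define d where "d = min (min d1 d2) (min d3 d4)"
    have d: "0 < d" "d \<le> d1" "d \<le> d2" "d \<le> d3" "d \<le> d4" using d1 d2 d3 d4 by (auto simp: d_def)
    have "p * h - \<epsilon> * \<bar>h\<bar> < \<sigma> h" if h: "h \<noteq> 0" "\<bar>h\<bar> < d" for h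
    proof (cases "0 < h")
      case True
      have "(p - \<epsilon>) * h < \<sigma> h"
        unfolding \<sigma>_def
        by (rule rho_gt_along[of \<theta>]) (use d1(2)[of h] d3(2)[of h] True h d in \<open>auto simp: F_def\<close>)
      then show ?thesis using True by (simp add: algebra_simps)
    next
      case False
      have "(p + \<epsilon>) * h < \<sigma> h"
        unfolding \<sigma>_def
        by (rule rho_gt_along[of \<theta>]) (use d2(2)[of "- h"] d4(2)[of h] False h d in \<open>auto simp: F_def\<close>)
      then show ?thesis using False h by (simp add: algebra_simps)
    qed
    then show ?thesis using d by blast
  qed
  have "(\<lambda>h. (\<sigma> (0 + h) - \<sigma> 0) / h) \<midarrow>0\<rightarrow> p"
  proof (rule LIM_I)
    fix e :: real assume e: "0 < e"
    then obtain d where d: "0 < d" "\<And>h. h \<noteq> 0 \<Longrightarrow> \<bar>h\<bar> < d \<Longrightarrow> p * h - e / 2 * \<bar>h\<bar> < \<sigma> h"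
      using lower[of "e / 2"] by auto
    have "norm ((\<sigma> (0 + h) - \<sigma> 0) / h - p) < e" if h: "h \<noteq> 0" "norm (h - 0) < d" for h
    proof -
      have "p * h - e / 2 * \<bar>h\<bar> < \<sigma> h" using d(2)[of h] h by simp
      then have "\<bar>\<sigma> h - p * h\<bar> \<le> e / 2 * \<bar>h\<bar>" using upper[of h] by linarith
      then have "\<bar>\<sigma> h - p * h\<bar> / \<bar>h\<bar> \<le> e / 2"
        using h by (simp add: pos_divide_le_eq)
      moreover have "\<sigma> h / h - p = (\<sigma> h - p * h) / h"
        using h by (simp add: diff_divide_distrib)
      ultimately have "\<bar>\<sigma> h / h - p\<bar> \<le> e / 2"
        by (simp add: abs_divide)
      then show ?thesis using e \<sigma>0 by simp
    qed
    then show "\<exists>s>0. \<forall>h. h \<noteq> 0 \<and> norm (h - 0) < s \<longrightarrow> norm ((\<sigma> (0 + h) - \<sigma> 0) / h - p) < e"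
      using d by blast
  qed
  then show ?thesis unfolding DERIV_def \<sigma>_def .
qed

lemma rho_derivative:
  "(rho R x has_real_derivative - height_moment \<theta> / (len_moment \<theta> * \<mu> * y)) (at y)"
proof -
  let ?p = "- height_moment \<theta> / len_moment \<theta>"
  let ?\<sigma> = "\<lambda>h. ln (rho R x (y * exp h) * \<mu>)"
  have "((\<lambda>z. ln (z / y)) has_real_derivative 1 / y) (at y)"
    using y_pos by (auto intro!: derivative_eq_intros simp: field_simps)
  moreover have "(?\<sigma> has_real_derivative ?p) (at (ln (y / y)))"
    using ln_rho_derivative[of \<theta>] y_pos by simp
  ultimately have "((\<lambda>z. 1 / \<mu> * exp (?\<sigma> (ln (z / y)))) has_real_derivative
      1 / \<mu> * (exp (?\<sigma> (ln (y / y))) * (?p * (1 / y)))) (at y)"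
    by (intro DERIV_cmult DERIV_chain2[where f = exp] DERIV_exp DERIV_chain2[where f = ?\<sigma>])
  also have "1 / \<mu> * (exp (?\<sigma> (ln (y / y))) * (?p * (1 / y))) = - height_moment \<theta> / (len_moment \<theta> * \<mu> * y)"
    using mu_pos y_pos by (simp add: rho_eq)
  finally have D: "((\<lambda>z. 1 / \<mu> * exp (?\<sigma> (ln (z / y)))) has_real_derivative
      - height_moment \<theta> / (len_moment \<theta> * \<mu> * y)) (at y)" .
  show ?thesis
  proof (rule has_field_derivative_transform_within[OF D, of y])
    fix z assume "dist z y < y"
    then have z: "0 < z" by (simp add: dist_real_def abs_less_iff)
    obtain \<mu>' \<omega>' where b: "perron R x z \<mu>' \<omega>'" "rho R x z = 1 / \<mu>'"
      using rho_at[OF z] by auto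
    interpret b: perron R x z \<mu>' \<omega>' by (rule b(1))
    show "1 / \<mu> * exp (?\<sigma> (ln (z / y))) = rho R x z"
      using z y_pos mu_pos b.mu_pos by (simp add: b(2))
  qed (use y_pos in simp_all)
qed

section \<open>The critical point and the drift\<close>

lemma B_t_derivative:
  "((\<lambda>u. gf (B_walks R \<theta>) u x y) has_real_derivative len_moment \<theta> * \<mu>) (at (1 / \<mu>))"
proof -
  let ?F = "\<lambda>h. gf (B_walks R \<theta>) (1 / \<mu> * exp h) x y"
  have F: "(?F has_real_derivative len_moment \<theta>) (at (ln (\<mu> * (1 / \<mu>))))"
    using B_directional_derivative(2)[of \<theta> 0 1] mu_pos by (simp add: gf_def)
  have "((\<lambda>u. ln (\<mu> * u)) has_real_derivative \<mu>) (at (1 / \<mu>))"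
    using mu_pos by (auto intro!: derivative_eq_intros)
  from DERIV_chain2[OF F this]
  have D: "((\<lambda>u. ?F (ln (\<mu> * u))) has_real_derivative len_moment \<theta> * \<mu>) (at (1 / \<mu>))" .
  show ?thesis
  proof (rule has_field_derivative_transform_within[OF D, of "1 / \<mu>"])
    fix u assume "dist u (1 / \<mu>) < 1 / \<mu>"
    then have "0 < u" by (simp add: dist_real_def abs_less_iff)
    then show "?F (ln (\<mu> * u)) = gf (B_walks R \<theta>) u x y" using mu_pos by simp
  qed (use mu_pos in simp_all)
qed

lemma B_y_derivative:
  "((\<lambda>u. gf (B_walks R \<theta>) (1 / \<mu>) x u) has_real_derivative height_moment \<theta> / y) (at y)"
proof -
  let ?F = "\<lambda>h. gf (B_walks R \<theta>) (1 / \<mu>) x (y * exp h)"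
  have F: "(?F has_real_derivative height_moment \<theta>) (at (ln (y / y)))"
    using B_directional_derivative(2)[of \<theta> 1 0] y_pos by (simp add: gf_def)
  have "((\<lambda>u. ln (u / y)) has_real_derivative 1 / y) (at y)"
    using y_pos by (auto intro!: derivative_eq_intros)
  from DERIV_chain2[OF F this]
  have D: "((\<lambda>u. ?F (ln (u / y))) has_real_derivative height_moment \<theta> / y) (at y)" by simp
  show ?thesis
  proof (rule has_field_derivative_transform_within[OF D, of y])
    fix u assume "dist u y < y"
    then have "0 < u" by (simp add: dist_real_def abs_less_iff)
    then show "?F (ln (u / y)) = gf (B_walks R \<theta>) (1 / \<mu>) x u" using y_pos by simp
  qed (use y_pos in simp_all)
qed

lemma B_t_eq: "B_t R \<theta> (rho R x y) x y = len_moment \<theta> * \<mu>"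
  unfolding B_t_def rho_eq by (rule DERIV_imp_deriv[OF B_t_derivative])

lemma vertical_drift_eq: "vertical_drift R \<theta> x y = height_moment \<theta> / (y * len_moment \<theta>)"
proof -
  have "B_y R \<theta> (rho R x y) x y = height_moment \<theta> / y"
    unfolding B_y_def rho_eq by (rule DERIV_imp_deriv[OF B_y_derivative])
  then show ?thesis
    using mu_pos unfolding vertical_drift_def B_t_eq by (simp add: rho_eq)
qed

lemma B_term_le_1:
  assumes "u \<in> B_walks R \<theta>"
  shows "walk_weight x y u * rho R x y ^ length u \<le> 1"
proof -
  have "walk_weight x y u \<le> gf_coeff (B_walks R \<theta>) (length u) x y"
    unfolding gf_coeff_eq using assms less_imp_le[OF walk_weight_pos[OF x_pos y_pos]]
    by (intro member_le_sum) auto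
  then have "walk_weight x y u * (1 / \<mu>) ^ length u \<le> gf_coeff (B_walks R \<theta>) (length u) x y * (1 / \<mu>) ^ length u"
    using mu_pos by (intro mult_right_mono) auto
  also have "\<dots> \<le> (\<Sum>n. gf_coeff (B_walks R \<theta>) n x y * (1 / \<mu>) ^ n)"
    using sum_le_suminf[of "\<lambda>n. gf_coeff (B_walks R \<theta>) n x y * (1 / \<mu>) ^ n" "{length u}"]
      B_sums_1[of \<theta>] B_coeff_nonneg mu_pos by (auto simp: sums_iff)
  also have "\<dots> = 1" using B_sums_1[of \<theta>] by (simp add: sums_iff)
  finally show ?thesis by (simp add: rho_eq)
qed

text \<open>
  At a critical point the tangent is horizontal. The walk of height \<open>-1\<close> in \<open>B_walks R South\<close> makes the inequality
  of \<open>rho_supporting_line\<close> strict along it.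
\<close>

lemma critical_imp_strict_max:
  assumes "vertically_unbounded R" "(rho R x has_real_derivative 0) (at y)" "0 < y'" "y' \<noteq> y"
  shows "rho R x y' < rho R x y"
proof -
  obtain \<mu>' \<omega>' where b: "perron R x y' \<mu>' \<omega>'" "rho R x y' = 1 / \<mu>'"
    using rho_at[OF assms(3)] by auto
  interpret b: perron R x y' \<mu>' \<omega>' by (rule b(1))
  have "- height_moment South / (len_moment South * \<mu> * y) = 0"
    by (rule DERIV_unique[OF rho_derivative assms(2)])
  then have hm: "height_moment South = 0"
    using len_moment_pos[of South] mu_pos y_pos by simp
  obtain u where u: "u \<in> B_walks R South" "height u = -1"
    using south_loopE[OF assms(1)] by metis
  have "len_moment South * ln (\<mu> / \<mu>') \<le> 0"
    using rho_supporting_line(1)[OF b(1), of South] by (simp add: hm)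
  then have "ln (\<mu> / \<mu>') \<le> 0" using len_moment_pos[of South] by (simp add: mult_le_0_iff)
  moreover have "ln (\<mu> / \<mu>') \<noteq> 0"
  proof
    assume 0: "ln (\<mu> / \<mu>') = 0"
    have "ln (y' / y) \<noteq> 0" using assms(3,4) y_pos by simp
    then have "len_moment South * ln (\<mu> / \<mu>') < 0"
      using rho_supporting_line(2)[OF b(1) u(1)] by (simp add: hm u(2) 0)
    then show False by (simp add: 0)
  qed
  ultimately have "ln (\<mu> / \<mu>') < 0" by linarith
  then have "\<mu> < \<mu>'" using mu_pos b.mu_pos by simp
  then show ?thesis using mu_pos b.mu_pos by (simp add: b(2) rho_eq frac_less2)
qed

end

text \<open>
  A single first return of height \<open>-1\<close> or \<open>1\<close> contributes at most 1 to \<open>B\<close> at the root, which bounds \<open>rho R x y\<close> for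
  small and for large \<open>y\<close>. So \<open>rho R x\<close> exceeds its value at 1 only on a compact interval, and its maximum is
  critical.
\<close>

lemma rho_has_critical_point:
  assumes "aperiodic R" "vertically_unbounded R" "0 < x"
  obtains y where "0 < y" "(rho R x has_real_derivative 0) (at y)"
proof -
  have perron: "\<exists>\<mu> \<omega>. perron R x y \<mu> \<omega>" if "0 < y" for y
    using perron_exists[OF assms(1,3) that] by metis
  have rho_pos: "0 < rho R x y" if "0 < y" for y
    using perron[OF that] by (metis perron.mu_pos perron.rho_eq zero_less_divide_1_iff)
  obtain u where u: "u \<in> B_walks R South" "height u = -1"
    using south_loopE[OF assms(2)] by metis
  obtain v where v: "v \<in> B_walks R North" "height v = 1"
    using north_loopE[OF assms(2)] by metis
  define lo where "lo = x powi fst (endpoint u) * rho R x 1 ^ length u"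
  define hi where "hi = 1 / (x powi fst (endpoint v) * rho R x 1 ^ length v)"
  have lo: "0 < lo" and hi: "0 < hi"
    using assms(3) rho_pos[of 1] by (auto simp: lo_def hi_def)
  have bounds: "lo \<le> y \<and> y \<le> hi" if y: "0 < y" and ge: "rho R x 1 \<le> rho R x y" for y
  proof -
    obtain \<mu> \<omega> where "perron R x y \<mu> \<omega>" using perron[OF y] by auto
    then interpret perron R x y \<mu> \<omega> .
    have pow: "rho R x 1 ^ n \<le> rho R x y ^ n" for n
      using ge rho_pos[of 1] by (intro power_mono) auto
    have "walk_weight x y w * rho R x 1 ^ length w \<le> 1" if "w \<in> B_walks R \<theta>" for w \<theta>
      using B_term_le_1[OF that] mult_left_mono[OF pow less_imp_le[OF walk_weight_pos[OF x_pos y]], of w "length w"]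
      by linarith
    from this[OF u(1)] this[OF v(1)] show ?thesis
      using y u(2) v(2) hi
      by (simp add: walk_weight_def lo_def hi_def power_int_minus field_simps flip: height_def)
  qed
  have lo1: "lo \<le> 1" "1 \<le> hi" using bounds[of 1] by auto
  have deriv: "\<exists>D. (rho R x has_real_derivative D) (at y)" if "0 < y" for y
    using perron[OF that] perron.rho_derivative by metis
  \<comment> \<open>The interval is larger than \<open>{lo..hi}\<close> to have the maximum in its interior.\<close>
  have "continuous_on {lo / 2..2 * hi} (rho R x)"
  proof (intro continuous_at_imp_continuous_on ballI)
    fix z assume "z \<in> {lo / 2..2 * hi}"
    then have "0 < z" using lo by auto
    then show "isCont (rho R x) z" using deriv DERIV_isCont by blast
  qed
  then obtain y where y: "y \<in> {lo / 2..2 * hi}" "\<And>z. z \<in> {lo / 2..2 * hi} \<Longrightarrow> rho R x z \<le> rho R x y"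
    using continuous_attains_sup[of "{lo / 2..2 * hi}" "rho R x"] lo1 lo hi by auto
  have y_pos: "0 < y" using y lo by auto
  have "rho R x 1 \<le> rho R x y" using y(2)[of 1] lo1 lo hi by auto
  then have yb: "lo \<le> y" "y \<le> hi" using bounds[OF y_pos] by auto
  obtain D where D: "(rho R x has_real_derivative D) (at y)" using deriv[OF y_pos] by auto
  have "\<forall>z. \<bar>y - z\<bar> < min (lo / 2) hi \<longrightarrow> rho R x z \<le> rho R x y"
  proof (intro allI impI)
    fix z assume "\<bar>y - z\<bar> < min (lo / 2) hi"
    then have "\<bar>y - z\<bar> < lo / 2" "\<bar>y - z\<bar> < hi" by simp_all
    then have "z \<in> {lo / 2..2 * hi}" using yb unfolding atLeastAtMost_iff by linarith
    then show "rho R x z \<le> rho R x y" by (rule y(2))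
  qed
  then have "D = 0"
    using lo hi by (intro DERIV_local_max[OF D, of "min (lo / 2) hi"]) auto
  then show ?thesis using that y_pos D by blast
qed

lemma tau_critical:
  assumes "aperiodic R" "vertically_unbounded R" "0 < x"
  shows "0 < tau R x" "(rho R x has_real_derivative 0) (at (tau R x))"
proof -
  obtain y where y: "0 < y" "(rho R x has_real_derivative 0) (at y)"
    using rho_has_critical_point[OF assms] by blast
  have max: "rho R x z' < rho R x z"
    if "0 < z" "(rho R x has_real_derivative 0) (at z)" "0 < z'" "z' \<noteq> z" for z z'
    using perron_exists[OF assms(1,3) that(1)] perron.critical_imp_strict_max[OF _ assms(2) that(2-4)]
    by metis
  have "z = y" if "0 < z" "(rho R x has_real_derivative 0) (at z)" for z
    using max[OF that y(1)] max[OF y that(1)] by fastforce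
  then have "\<exists>!z. 0 < z \<and> (rho R x has_real_derivative 0) (at z)"
    using y by blast
  from theI'[OF this] show "0 < tau R x" "(rho R x has_real_derivative 0) (at (tau R x))"
    unfolding tau_def by blast+
qed

text \<open>
  The tangent of \<open>ln (rho R x)\<close> at \<open>y\<close> does not pass below the point at \<open>tau R x\<close>, which is higher and to the
  left, so it descends.
  Its slope in \<open>ln y\<close> is \<open>- height_moment \<theta> / len_moment \<theta>\<close>.
\<close>

lemma above_tau:
  assumes "aperiodic R" "vertically_unbounded R" "0 < x" "tau R x < y"
  obtains \<mu> \<omega> \<mu>' \<omega>' where "perron R x y \<mu> \<omega>" "perron R x (tau R x) \<mu>' \<omega>'" "\<mu>' < \<mu>"
    "\<And>\<theta>. 0 < vertical_drift R \<theta> x y"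
proof -
  note tau = tau_critical[OF assms(1-3)]
  have y: "0 < y" using tau(1) assms(4) by simp
  obtain \<mu> \<omega> where "perron R x y \<mu> \<omega>" using perron_exists[OF assms(1,3) y] by blast
  then interpret perron R x y \<mu> \<omega> .
  obtain \<mu>' \<omega>' where t: "perron R x (tau R x) \<mu>' \<omega>'" using perron_exists[OF assms(1,3) tau(1)] by blast
  interpret t: perron R x "tau R x" \<mu>' \<omega>' by (rule t)
  have "1 / \<mu> < 1 / \<mu>'"
    using t.critical_imp_strict_max[OF assms(2) tau(2) y] assms(4) by (simp add: rho_eq t.rho_eq)
  then have less: "\<mu>' < \<mu>" using mu_pos t.mu_pos by (simp add: field_simps)
  have "0 < vertical_drift R \<theta> x y" for \<theta>
  proof -
    have "0 < len_moment \<theta> * ln (\<mu> / \<mu>')"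
      using len_moment_pos less t.mu_pos by simp
    then have "height_moment \<theta> * ln (tau R x / y) < 0"
      using rho_supporting_line(1)[OF t, of \<theta>] by linarith
    moreover have "ln (tau R x / y) < 0"
      using tau(1) y assms(4) by simp
    ultimately have "0 < height_moment \<theta>"
      by (simp add: mult_less_0_iff)
    then show ?thesis unfolding vertical_drift_eq using y len_moment_pos[of \<theta>] by simp
  qed
  then show ?thesis using that \<open>perron R x y \<mu> \<omega>\<close> t less by blast
qed

section \<open>Singularity analysis\<close>

lemma fps_conv_radius_gtI:
  fixes F :: "complex fps"
  assumes "0 \<le> c" "c < \<mu>" "\<And>n. norm (fps_nth F n) \<le> K * c ^ n"
  shows "ereal (1 / \<mu>) < fps_conv_radius F"
proof -
  define r where "r = 2 / (c + \<mu>)"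
  have r: "0 < r" "1 / \<mu> < r" "c * r < 1" "0 \<le> c * r"
    using assms(1,2) by (auto simp: r_def field_simps)
  have "summable (\<lambda>n. fps_nth F n * of_real r ^ n)"
  proof (rule summable_comparison_test'[of "\<lambda>n. K * (c * r) ^ n" 0])
    show "summable (\<lambda>n. K * (c * r) ^ n)"
      using r by (intro summable_mult summable_geometric) simp
    fix n
    have "norm (fps_nth F n) * r ^ n \<le> K * c ^ n * r ^ n"
      using assms(3) r by (intro mult_right_mono) auto
    then show "norm (fps_nth F n * of_real r ^ n) \<le> K * (c * r) ^ n"
      using r by (simp add: norm_mult norm_power power_mult_distrib mult_ac)
  qed
  then have "ereal (norm (of_real r :: complex)) \<le> fps_conv_radius F"
    unfolding fps_conv_radius_def by (rule conv_radius_geI)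
  then have "ereal r \<le> fps_conv_radius F" using r by simp
  with r(2) show ?thesis by (metis ereal_less_le less_ereal.simps(1) order_less_le_trans)
qed

text \<open>
  Multiplication by \<open>1 - X / p\<close> takes differences of the rescaled coefficients \<open>fps_nth H n * p ^ n\<close>. Their
  convergence thus becomes the convergence at \<open>p\<close> of the series with the pole removed.
\<close>

lemma fps_X_factor_nth_sum:
  fixes H :: "complex fps"
  assumes "p \<noteq> 0"
  shows "(\<Sum>i\<le>n. fps_nth (H * (1 - fps_const (1 / p) * fps_X)) i * p ^ i) = fps_nth H n * p ^ n"
proof (induction n)
  case 0
  then show ?case by simp
next
  case (Suc n)
  have "fps_nth (H * (1 - fps_const (1 / p) * fps_X)) (Suc n) = fps_nth H (Suc n) - fps_nth H n / p"
    by (simp add: algebra_simps)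
  then show ?case using Suc assms by (simp add: algebra_simps)
qed

text \<open>
  By Riemann's theorem on removable singularities \<open>1 - B = q * (1 - X / p)\<close> with \<open>q\<close> holomorphic. As \<open>p\<close> is the
  only root of \<open>B = 1\<close> in the closed disc and it is simple, \<open>q\<close> has no zero there, hence none in a slightly
  larger disc, and \<open>k = N / q\<close> is \<open>H\<close> with the pole removed.
\<close>

lemma renewal_factorization:
  fixes H B N :: "complex fps" and p :: complex
  assumes eq: "H * (1 - B) = N"
    and rad: "ereal (norm p) < fps_conv_radius B" "ereal (norm p) < fps_conv_radius N"
    and p: "p \<noteq> 0" "eval_fps B p = 1" "deriv (eval_fps B) p \<noteq> 0"
    and unique: "\<And>t. norm t \<le> norm p \<Longrightarrow> eval_fps B t = 1 \<Longrightarrow> t = p"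
  obtains k r where "norm p < r" "k holomorphic_on ball 0 r"
    "fps_expansion k 0 = H * (1 - fps_const (1 / p) * fps_X)"
    "k p = eval_fps N p / (p * deriv (eval_fps B) p)"
proof -
  obtain s where s: "norm p < s" "ereal s < fps_conv_radius B" "ereal s < fps_conv_radius N"
  proof -
    have "ereal (norm p) < min (fps_conv_radius B) (fps_conv_radius N)" using rad by simp
    then obtain s where "ereal (norm p) < ereal s" "ereal s < min (fps_conv_radius B) (fps_conv_radius N)"
      using ereal_dense2 by blast
    then show ?thesis using that by simp
  qed
  have s_pos: "0 < s" using s(1) norm_ge_zero[of p] by linarith
  have "ball (0 :: complex) s \<subseteq> eball 0 \<rho>" if "ereal s < \<rho>" for \<rho>
  proof
    fix z :: complex assume "z \<in> ball 0 s"
    then have "ereal (dist 0 z) < ereal s" by simp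
    also note that
    finally show "z \<in> eball 0 \<rho>" by (simp add: in_eball_iff)
  qed
  then have ball: "ball (0 :: complex) s \<subseteq> eball 0 (fps_conv_radius B)"
    "ball (0 :: complex) s \<subseteq> eball 0 (fps_conv_radius N)"
    using s by blast+
  have holo: "eval_fps B holomorphic_on ball 0 s" "eval_fps N holomorphic_on ball 0 s"
    using ball by (auto intro: holomorphic_on_eval_fps)
  define g where "g t = (if t = p then deriv (eval_fps B) p else (eval_fps B t - eval_fps B p) / (t - p))" for t
  define q where "q t = p * g t" for t
  have "g holomorphic_on ball 0 s"
    unfolding g_def by (rule pole_lemma_open[OF holo(1) open_ball])
  then have q_holo: "q holomorphic_on ball 0 s"
    unfolding q_def by (intro holomorphic_intros)
  have q_eq: "1 - eval_fps B t = q t * (1 - 1 / p * t)" for t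
  proof (cases "t = p")
    case False
    then show ?thesis using p(1,2) by (simp add: q_def g_def field_simps)
  qed (use p in simp)
  have q_nz: "q t \<noteq> 0" if "norm t \<le> norm p" for t
  proof
    assume "q t = 0"
    then have "eval_fps B t = 1" using q_eq[of t] by simp
    then have "t = p" using unique that by blast
    then show False using \<open>q t = 0\<close> p(1,3) by (simp add: q_def g_def)
  qed
  \<comment> \<open>The zeros of \<open>q\<close> in a compact disc form a compact set, so one of least modulus exists.\<close>
  obtain r where r: "norm p < r" "r \<le> s" "\<And>t. t \<in> ball 0 r \<Longrightarrow> q t \<noteq> 0"
  proof -
    obtain s' where s': "norm p < s'" "s' < s" using s(1) dense by blast
    have "continuous_on (cball 0 s') q"
      using s'(2) by (intro holomorphic_on_imp_continuous_on holomorphic_on_subset[OF q_holo]) auto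
    then have "closed {t \<in> cball 0 s'. q t = 0}"
      using continuous_closed_preimage_constant[of "cball 0 s'" q 0] by simp
    then have "compact (cball 0 s' \<inter> {t \<in> cball 0 s'. q t = 0})"
      by (intro compact_Int_closed compact_cball)
    then have compact: "compact {t \<in> cball 0 s'. q t = 0}"
      by (simp add: Int_def conj_ac)
    show ?thesis
    proof (cases "{t \<in> cball 0 s'. q t = 0} = {}")
      case True
      then show ?thesis using that[of s'] s' by (auto simp: less_imp_le)
    next
      case False
      then obtain z where z: "z \<in> {t \<in> cball 0 s'. q t = 0}"
        "\<And>t. t \<in> {t \<in> cball 0 s'. q t = 0} \<Longrightarrow> norm z \<le> norm t"
        using continuous_attains_inf[OF compact False continuous_on_norm_id] by auto
      have "norm p < norm z" using z(1) q_nz[of z] by force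
      moreover have "q t \<noteq> 0" if "t \<in> ball 0 (norm z)" for t
        using z(1) z(2)[of t] that by auto
      ultimately show ?thesis using that[of "norm z"] z(1) s' by auto
    qed
  qed
  have r_pos: "0 < r" using r(1) norm_ge_zero[of p] by linarith
  define k where "k t = eval_fps N t / q t" for t
  have k_holo: "k holomorphic_on ball 0 r"
    unfolding k_def using r holo(2) q_holo
    by (intro holomorphic_on_divide) (auto elim!: holomorphic_on_subset)
  define qf where "qf = fps_expansion q 0"
  define kf where "kf = fps_expansion k 0"
  have qE: "q has_fps_expansion qf"
    unfolding qf_def using q_holo s_pos by (intro has_fps_expansion_fps_expansion[of "ball 0 s"]) auto
  have kE: "k has_fps_expansion kf"
    unfolding kf_def using k_holo r_pos by (intro has_fps_expansion_fps_expansion[of "ball 0 r"]) auto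
  have rad0: "0 < fps_conv_radius B" "0 < fps_conv_radius N"
    using rad by (auto intro: le_less_trans[rotated])
  have BE: "eval_fps B has_fps_expansion B" and NE: "eval_fps N has_fps_expansion N"
    using rad0 by (auto intro: eval_fps_has_fps_expansion)
  have "(\<lambda>t. q t * (1 - 1 / p * t)) has_fps_expansion qf * (1 - fps_const (1 / p) * fps_X)"
    by (intro fps_expansion_intros qE)
  moreover have "(\<lambda>t. q t * (1 - 1 / p * t)) has_fps_expansion 1 - B"
    unfolding q_eq[symmetric] by (intro fps_expansion_intros BE)
  ultimately have qf: "qf * (1 - fps_const (1 / p) * fps_X) = 1 - B"
    by (rule fps_expansion_unique_complex)
  have "(\<lambda>t. k t * q t) has_fps_expansion kf * qf"
    by (intro fps_expansion_intros kE qE)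
  moreover have "(\<lambda>t. k t * q t) has_fps_expansion N"
  proof -
    have "\<forall>\<^sub>F t in nhds 0. t \<in> ball 0 r"
      using r_pos by (intro eventually_nhds_in_open) auto
    then have "\<forall>\<^sub>F t in nhds 0. k t * q t = eval_fps N t"
      by eventually_elim (use r(3) in \<open>simp add: k_def\<close>)
    then have "(\<lambda>t. k t * q t) has_fps_expansion N \<longleftrightarrow> eval_fps N has_fps_expansion N"
      by (rule has_fps_expansion_cong) simp
    then show ?thesis using NE by simp
  qed
  ultimately have kq: "kf * qf = N" by (rule fps_expansion_unique_complex)
  have "qf \<noteq> 0"
  proof
    assume "qf = 0"
    then have "q 0 = 0" using has_fps_expansion_imp_0_eq_fps_nth_0[OF qE] by simp
    then show False using q_nz[of 0] by simp
  qed
  moreover have "(H * (1 - fps_const (1 / p) * fps_X)) * qf = kf * qf"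
    using eq unfolding kq qf[symmetric] by (simp add: mult_ac)
  ultimately have "kf = H * (1 - fps_const (1 / p) * fps_X)" by simp
  moreover have "k p = eval_fps N p / (p * deriv (eval_fps B) p)"
    by (simp add: k_def q_def g_def)
  ultimately show ?thesis using that[of r k] r(1) k_holo unfolding kf_def by blast
qed

lemma coefficient_limit:
  assumes "p \<noteq> 0" "norm p < r" "k holomorphic_on ball 0 r"
    "fps_expansion k 0 = H * (1 - fps_const (1 / p) * fps_X)"
  shows "(\<lambda>n. fps_nth H n * p ^ n) \<longlonglongrightarrow> k p"
proof -
  have "(\<lambda>n. fps_nth (fps_expansion k 0) n * p ^ n) sums k p"
    using holomorphic_power_series[OF assms(3), of p] assms(2) by (simp add: fps_expansion_def)
  then show ?thesis
    unfolding assms(4) sums_def_le fps_X_factor_nth_sum[OF assms(1)] .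
qed

lemma dominant_simple_poleI:
  assumes p: "p \<noteq> 0" and r: "norm p < r" "k holomorphic_on ball 0 r"
    and H: "fps_expansion k 0 = H * (1 - fps_const (1 / p) * fps_X)"
    and k: "k p \<noteq> 0"
  shows "dominant_simple_pole (fps_nth H) p (\<lambda>t. k t / (1 - t / p))"
    and "(\<lambda>t. k t / (1 - t / p)) \<sim>[at p] (\<lambda>t. k p * (1 / (1 - t / p)))"
proof -
  have p_ball: "p \<in> ball 0 r" using r by simp
  have nz: "1 - t / p \<noteq> 0" if "t \<noteq> p" for t
    using that p by (simp add: field_simps)
  have k_cont: "isCont k p"
    using r p_ball by (meson continuous_on_eq_continuous_at holomorphic_on_imp_continuous_on open_ball)
  have "(\<lambda>m. fps_nth H m * t ^ m) sums (k t / (1 - t / p))" if t: "norm t < norm p" for t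
  proof -
    obtain M where M: "\<And>n. norm (fps_nth H n * p ^ n) \<le> M"
      using convergent_imp_Bseq[OF convergentI[OF coefficient_limit[OF p r H]]] by (auto elim!: BseqE)
    have bound: "norm (fps_nth H n) \<le> M * (1 / norm p) ^ n" for n
      using M[of n] p by (simp add: norm_mult norm_power field_simps)
    have rad_H: "ereal (norm t) < fps_conv_radius H"
    proof -
      obtain u where u: "norm t < u" "u < norm p" using t dense by blast
      have u0: "0 < u" using u(1) norm_ge_zero[of t] by linarith
      have "1 / norm p < 1 / u" using u u0 by (intro frac_less2) auto
      then have "ereal (1 / (1 / u)) < fps_conv_radius H"
        by (intro fps_conv_radius_gtI[OF _ _ bound]) auto
      then show ?thesis using u(1) by (simp add: less_trans[of _ "ereal u"])
    qed
    have rad_X: "fps_conv_radius (fps_const (1 / p) * fps_X) = \<infinity>"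
      using p by (subst fps_conv_radius_cmult_left) auto
    then have lin: "eval_fps (1 - fps_const (1 / p) * fps_X) t = 1 - t / p"
      by (simp add: eval_fps_diff eval_fps_mult)
    have lin_rad: "fps_conv_radius (1 - fps_const (1 / p) * fps_X) = \<infinity>"
      using fps_conv_radius_diff[of 1 "fps_const (1 / p) * fps_X"] rad_X by simp
    have "eval_fps (fps_expansion k 0) t = k t"
      using r t holomorphic_power_series[OF r(2), of t] by (simp add: eval_fps_def fps_expansion_def sums_iff)
    then have "k t = eval_fps H t * (1 - t / p)"
      unfolding H using rad_H lin lin_rad by (simp add: eval_fps_mult)
    moreover have "t \<noteq> p" using t by auto
    ultimately have "eval_fps H t = k t / (1 - t / p)" using nz[of t] by simp
    then show ?thesis using sums_eval_fps[OF rad_H] by simp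
  qed
  moreover have "(\<lambda>t. k t / (1 - t / p)) holomorphic_on (ball 0 r - {p})"
    using r nz p by (intro holomorphic_intros) (auto elim: holomorphic_on_subset)
  moreover have "is_pole (\<lambda>t. k t / (1 - t / p)) p"
  proof (rule is_pole_divide[OF k_cont _ k])
    show "filterlim (\<lambda>t. 1 - t / p) (at 0) (at p)"
    proof (rule filterlim_atI)
      show "((\<lambda>t. 1 - t / p) \<longlongrightarrow> 0) (at p)"
        using p by (auto intro!: tendsto_eq_intros)
      show "\<forall>\<^sub>F t in at p. 1 - t / p \<noteq> 0"
        unfolding eventually_at_filter using nz by simp
    qed
  qed
  moreover have "zorder (\<lambda>t. k t / (1 - t / p)) p = -1"
  proof (rule zorder_eqI[of "ball 0 r" _ "\<lambda>t. - p * k t"])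
    show "(\<lambda>t. - p * k t) holomorphic_on ball 0 r"
      using r by (intro holomorphic_intros)
    fix t assume "t \<noteq> p"
    then show "k t / (1 - t / p) = - p * k t * (t - p) powi -1"
      using p by (simp add: power_int_minus field_simps)
  qed (use p k p_ball in auto)
  ultimately show "dominant_simple_pole (fps_nth H) p (\<lambda>t. k t / (1 - t / p))"
    unfolding dominant_simple_pole_def using r(1) by auto
  have "((\<lambda>t. k t / k p) \<longlongrightarrow> k p / k p) (at p)"
    using k_cont k by (intro tendsto_intros) (auto simp: isCont_def)
  then have "((\<lambda>t. k t / k p) \<longlongrightarrow> 1) (at p)" using k by simp
  moreover have "\<forall>\<^sub>F t in at p. k t / k p = (k t / (1 - t / p)) / (k p * (1 / (1 - t / p)))"
    unfolding eventually_at_filter using nz by (intro always_eventually) simp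
  ultimately have "((\<lambda>t. (k t / (1 - t / p)) / (k p * (1 / (1 - t / p)))) \<longlongrightarrow> 1) (at p)"
    by (rule Lim_transform_eventually)
  then show "(\<lambda>t. k t / (1 - t / p)) \<sim>[at p] (\<lambda>t. k p * (1 / (1 - t / p)))"
    by (rule asymp_equivI')
qed

section \<open>The dominant pole of half-plane walks\<close>

lemma eval_fps_of_real:
  assumes "ereal \<bar>t\<bar> < fps_conv_radius (gf_fps W x y)"
  shows "eval_fps (gf_fps W x y) (of_real t) = of_real (gf W t x y)"
proof -
  have "summable (\<lambda>n. of_real (gf_coeff W n x y) * (of_real t :: complex) ^ n)"
    using summable_fps[of "of_real t" "gf_fps W x y"] assms by simp
  then have "summable (\<lambda>n. complex_of_real (gf_coeff W n x y * t ^ n))" by simp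
  then have "summable (\<lambda>n. gf_coeff W n x y * t ^ n)" by (simp only: summable_of_real_iff)
  then show ?thesis
    by (simp add: eval_fps_def gf_def suminf_of_real)
qed

context perron begin

lemma passage_union_radius:
  assumes "\<And>n. gf_coeff W n x y = (\<Sum>s\<in>S. gf_coeff (passage_walks R \<theta> s) n x y)"
  shows "ereal (1 / \<mu>) < fps_conv_radius (gf_fps W x y)"
proof -
  obtain \<kappa> K where \<kappa>: "0 < \<kappa>" "\<kappa> < 1" "0 < K"
    "\<And>n s. gf_coeff (passage_walks R \<theta> s) n x y \<le> K * (\<kappa> * \<mu>) ^ n"
    using passage_decay[of \<theta>] by blast
  have bound: "norm (fps_nth (gf_fps W x y) n) \<le> real (card S) * K * (\<kappa> * \<mu>) ^ n" for n
  proof -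
    have "gf_coeff W n x y \<le> real (card S) * (K * (\<kappa> * \<mu>) ^ n)"
      unfolding assms by (rule sum_bounded_above) (rule \<kappa>(4))
    moreover have "0 \<le> gf_coeff W n x y" using x_pos y_pos by (simp add: gf_coeff_nonneg)
    ultimately show ?thesis by simp
  qed
  show ?thesis
    by (rule fps_conv_radius_gtI[OF _ _ bound]) (use \<kappa> mu_pos in auto)
qed

lemma B_radius: "ereal (1 / \<mu>) < fps_conv_radius (gf_fps (B_walks R \<theta>) x y)"
  by (rule passage_union_radius) (rule B_coeff)

lemma C_radius: "ereal (1 / \<mu>) < fps_conv_radius (gf_fps (C_walks R \<theta>) x y)"
  by (rule passage_union_radius) (rule C_coeff)

lemma D_radius: "ereal (1 / \<mu>) < fps_conv_radius (gf_fps (D_walks R \<theta>) x y)"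
  by (rule passage_union_radius[where S = "{South}"]) (simp add: D_walks_eq)

text \<open>
  Used at \<open>tau R x\<close>: walks ending on the ground grow no faster than all half-plane walks there.
\<close>

lemma ground_radius:
  assumes "\<mu> < \<nu>"
  shows "ereal (1 / \<nu>) < fps_conv_radius (gf_fps (H_walks R \<phi>) x 0)"
proof -
  obtain K where K: "0 < K" "\<And>n. gf_coeff (H_walks R \<phi>) n x y \<le> K * \<mu> ^ n"
    using H_upper[of \<phi>] by blast
  have bound: "norm (fps_nth (gf_fps (H_walks R \<phi>) x 0) n) \<le> K * \<mu> ^ n" for n
  proof -
    have "gf_coeff (H_walks R \<phi>) n x 0 \<le> gf_coeff (H_walks R \<phi>) n x y"
      unfolding H_coeff_ground[of R \<phi> n x y] using x_pos y_pos by (intro gf_coeff_mono) auto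
    moreover have "0 \<le> gf_coeff (H_walks R \<phi>) n x 0" using x_pos by (simp add: gf_coeff_nonneg)
    ultimately show ?thesis using K(2)[of n] by simp
  qed
  show ?thesis
    by (rule fps_conv_radius_gtI[OF _ assms bound]) (use mu_pos in simp)
qed

lemma eval_B:
  "eval_fps (gf_fps (B_walks R \<theta>) x y) (of_real (1 / \<mu>)) = 1"
  "deriv (eval_fps (gf_fps (B_walks R \<theta>) x y)) (of_real (1 / \<mu>)) = of_real (B_t R \<theta> (rho R x y) x y)"
proof -
  have r: "ereal \<bar>1 / \<mu>\<bar> < fps_conv_radius (gf_fps (B_walks R \<theta>) x y)"
    using B_radius[of \<theta>] mu_pos by simp
  show "eval_fps (gf_fps (B_walks R \<theta>) x y) (of_real (1 / \<mu>)) = 1"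
    unfolding eval_fps_of_real[OF r] using sums_unique[OF B_sums_1[of \<theta>]] by (simp add: gf_def)
  have r': "ereal (norm (complex_of_real (1 / \<mu>))) < fps_conv_radius (gf_fps (B_walks R \<theta>) x y)"
    using r by (simp only: norm_of_real)
  have "(\<lambda>n. real (Suc n) * (gf_coeff (B_walks R \<theta>) (Suc n) x y * (1 / \<mu>) ^ Suc n)) sums len_moment \<theta>"
    using len_sums[of \<theta>] by (subst sums_Suc_iff) simp
  from sums_mult[OF this, of \<mu>]
  moreover have "\<mu> * (real (Suc n) * (b * (1 / \<mu>) ^ Suc n)) = real (Suc n) * b * (1 / \<mu>) ^ n" for n b
    using mu_pos by simp
  ultimately have "(\<lambda>n. real (Suc n) * gf_coeff (B_walks R \<theta>) (Suc n) x y * (1 / \<mu>) ^ n) sums (\<mu> * len_moment \<theta>)"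
    by (simp only:)
  then have "(\<lambda>n. complex_of_real (real (Suc n) * gf_coeff (B_walks R \<theta>) (Suc n) x y * (1 / \<mu>) ^ n))
      sums of_real (\<mu> * len_moment \<theta>)"
    by (rule sums_of_real)
  then have "eval_fps (fps_deriv (gf_fps (B_walks R \<theta>) x y)) (of_real (1 / \<mu>)) = of_real (\<mu> * len_moment \<theta>)"
    unfolding eval_fps_def by (simp add: sums_iff)
  moreover have "deriv (eval_fps (gf_fps (B_walks R \<theta>) x y)) (of_real (1 / \<mu>)) =
      eval_fps (fps_deriv (gf_fps (B_walks R \<theta>) x y)) (of_real (1 / \<mu>))"
    by (rule DERIV_imp_deriv[OF has_field_derivative_eval_fps[OF r']])
  ultimately show "deriv (eval_fps (gf_fps (B_walks R \<theta>) x y)) (of_real (1 / \<mu>)) = of_real (B_t R \<theta> (rho R x y) x y)"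
    by (simp add: B_t_eq mult.commute)
qed

end

theorem lemma13:
  fixes R :: rule and \<theta> :: step and x y :: real
  assumes "aperiodic R" and "vertically_unbounded R"
    and "0 < x" and "tau R x < y"
  shows "0 < vertical_drift R \<theta> x y \<and>
    (\<exists>h. dominant_simple_pole (\<lambda>m. of_real (gf_coeff (H_walks R \<theta>) m x y))
            (of_real (rho R x y)) h \<and>
         h \<sim>[at (of_real (rho R x y))]
           (\<lambda>t. of_real (c_plus R \<theta> x y) * (1 / (1 - t / of_real (rho R x y))))) \<and>
    (\<lambda>m. gf_coeff (H_walks R \<theta>) m x y) \<sim>[at_top] (\<lambda>m. c_plus R \<theta> x y * mu R x y ^ m)"
proof -
  obtain \<mu> \<omega> \<mu>' \<omega>' where hi: "perron R x y \<mu> \<omega>" and lo: "perron R x (tau R x) \<mu>' \<omega>'"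
    and less: "\<mu>' < \<mu>" and drift: "0 < vertical_drift R \<theta> x y"
    using above_tau[OF assms] by metis
  interpret perron R x y \<mu> \<omega> by (rule hi)
  interpret lo: perron R x "tau R x" \<mu>' \<omega>' by (rule lo)
  define r where "r = rho R x y"
  have r: "r = 1 / \<mu>" "0 < r" using mu_pos by (auto simp: r_def rho_eq)
  define p where "p = complex_of_real r"
  have "norm p = r" using r(2) by (simp add: p_def)
  then have p: "p = of_real (1 / \<mu>)" "norm p = 1 / \<mu>" "p \<noteq> 0" using r by (auto simp: p_def)
  define H where "H = gf_fps (H_walks R \<theta>) x y"
  define B where "B = gf_fps (B_walks R \<theta>) x y"
  define C where "C = gf_fps (C_walks R \<theta>) x y"
  define D where "D = gf_fps (D_walks R \<theta>) x y"
  define G where "G \<phi> = gf_fps (H_walks R \<phi>) x 0" for \<phi>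
  define N where "N = C - D * (\<Sum>\<phi> | R \<phi> South. G \<phi>)"
  have kernel: "H * (1 - B) = N"
    unfolding H_def B_def N_def C_def D_def G_def using x_pos y_pos by (intro kernel_equation) auto
  have rad: "ereal (norm p) < fps_conv_radius B" "ereal (norm p) < fps_conv_radius C"
    "ereal (norm p) < fps_conv_radius D" "ereal (norm p) < fps_conv_radius (G \<phi>)" for \<phi>
    unfolding p(2) B_def C_def D_def G_def
    using B_radius C_radius D_radius lo.ground_radius[OF less] by auto
  have rad_sum: "ereal (norm p) < fps_conv_radius (\<Sum>\<phi>\<in>S. G \<phi>) \<and>
      eval_fps (\<Sum>\<phi>\<in>S. G \<phi>) p = (\<Sum>\<phi>\<in>S. eval_fps (G \<phi>) p)" for S
  proof (induction S rule: infinite_finite_induct)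
    case (insert \<phi> S)
    have "ereal (norm p) < fps_conv_radius (G \<phi> + (\<Sum>\<phi>\<in>S. G \<phi>))"
      using rad(4)[of \<phi>] insert.IH by (intro less_le_trans[OF _ fps_conv_radius_add]) simp
    then show ?case
      using insert rad(4)[of \<phi>] by (simp add: eval_fps_add)
  qed auto
  let ?G = "\<Sum>\<phi> | R \<phi> South. G \<phi>"
  have rad_DG: "ereal (norm p) < fps_conv_radius (D * ?G)"
    using rad(3) rad_sum by (intro less_le_trans[OF _ fps_conv_radius_mult]) simp
  have rad_N: "ereal (norm p) < fps_conv_radius N"
    unfolding N_def using rad(2) rad_DG by (intro less_le_trans[OF _ fps_conv_radius_diff]) simp
  have real: "eval_fps (gf_fps W x z) p = of_real (gf W r x z)"
    if "ereal (norm p) < fps_conv_radius (gf_fps W x z)" for W z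
    using eval_fps_of_real[of r W x z] that r(2) by (simp add: p_def)
  have "eval_fps N p = eval_fps C p - eval_fps D p * (\<Sum>\<phi> | R \<phi> South. eval_fps (G \<phi>) p)"
    unfolding N_def using rad rad_DG rad_sum by (simp add: eval_fps_diff eval_fps_mult)
  also have "\<dots> = of_real (gf (C_walks R \<theta>) r x y - gf (D_walks R \<theta>) r x y * H_star R r x 0)"
    using rad by (simp add: C_def D_def G_def real H_star_def)
  finally have N: "eval_fps N p =
    of_real (gf (C_walks R \<theta>) r x y - gf (D_walks R \<theta>) r x y * H_star R r x 0)" .
  have B1: "eval_fps B p = 1" and B': "deriv (eval_fps B) p = of_real (B_t R \<theta> r x y)"
    unfolding B_def p(1) r_def by (rule eval_B)+
  have "0 < B_t R \<theta> r x y"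
    unfolding r_def B_t_eq using len_moment_pos mu_pos by simp
  then have B'_nz: "deriv (eval_fps B) p \<noteq> 0" by (simp add: B')
  have unique: "t = p" if "norm t \<le> norm p" "eval_fps B t = 1" for t
  proof -
    have "ereal (norm t) < fps_conv_radius B"
      using that(1) rad(1) by (metis ereal_less_eq(3) order_le_less_trans)
    from sums_eval_fps[OF this] have "(\<lambda>n. of_real (gf_coeff (B_walks R \<theta>) n x y) * t ^ n) sums 1"
      using that(2) by (simp add: B_def)
    moreover have "norm t \<le> 1 / \<mu>" using that(1) by (simp only: p(2))
    ultimately show ?thesis unfolding p(1) by (intro B_unique_root)
  qed
  obtain k s where k: "norm p < s" "k holomorphic_on ball 0 s"
    "fps_expansion k 0 = H * (1 - fps_const (1 / p) * fps_X)"
    "k p = eval_fps N p / (p * deriv (eval_fps B) p)"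
    using renewal_factorization[OF kernel rad(1) rad_N p(3) B1 B'_nz unique] by metis
  define c where "c = c_plus R \<theta> x y"
  have kp: "k p = of_real c"
    unfolding k(4) N B' c_def c_plus_def Let_def r_def[symmetric] by (simp add: p_def)
  have "(\<lambda>n. fps_nth H n * p ^ n) \<longlonglongrightarrow> k p"
    by (rule coefficient_limit[OF p(3) k(1-3)])
  then have "(\<lambda>n. complex_of_real (gf_coeff (H_walks R \<theta>) n x y * r ^ n)) \<longlonglongrightarrow> of_real c"
    unfolding kp by (simp add: H_def p_def)
  then have lim: "(\<lambda>n. gf_coeff (H_walks R \<theta>) n x y * r ^ n) \<longlonglongrightarrow> c"
    by (simp only: tendsto_of_real_iff)
  \<comment> \<open>A positive limit rules out that the singularity is removable.\<close>
  obtain c0 M where c0: "0 < c0" "\<And>n. M \<le> n \<Longrightarrow> c0 * \<mu> ^ n \<le> gf_coeff (H_walks R \<theta>) n x y"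
    using H_lower[OF hi lo less_imp_le[OF less] assms(4,2), of \<theta>] by metis
  have "c0 \<le> gf_coeff (H_walks R \<theta>) n x y * r ^ n" if "M \<le> n" for n
  proof -
    have "c0 = c0 * \<mu> ^ n * r ^ n" using mu_pos by (simp add: r(1) power_one_over)
    also have "\<dots> \<le> gf_coeff (H_walks R \<theta>) n x y * r ^ n"
      using c0(2)[OF that] r(2) by (intro mult_right_mono) auto
    finally show ?thesis .
  qed
  then have "c0 \<le> c" using LIMSEQ_le_const[OF lim] by blast
  then have c_pos: "0 < c" using c0(1) by simp
  then have kp_nz: "k p \<noteq> 0" by (simp add: kp)
  have pole: "dominant_simple_pole (\<lambda>m. of_real (gf_coeff (H_walks R \<theta>) m x y)) p (\<lambda>t. k t / (1 - t / p))"
    using dominant_simple_poleI(1)[OF p(3) k(1-3) kp_nz] by (simp add: H_def gf_fps_def Abs_fps_inverse)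
  have asymp: "(\<lambda>t. k t / (1 - t / p)) \<sim>[at p] (\<lambda>t. of_real c * (1 / (1 - t / p)))"
    using dominant_simple_poleI(2)[OF p(3) k(1-3) kp_nz] unfolding kp .
  have "((\<lambda>n. gf_coeff (H_walks R \<theta>) n x y / mu R x y ^ n) \<longlongrightarrow> c) at_top"
    using lim r by (simp add: mu_def r_def rho_eq field_simps)
  then have "(\<lambda>m. gf_coeff (H_walks R \<theta>) m x y) \<sim>[at_top] (\<lambda>m. c * mu R x y ^ m)"
    using c_pos by (intro asymp_equivI'_const) auto
  then show ?thesis
    using drift pole asymp unfolding p_def r_def c_def by blast
qed

end
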